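(* Let $N\ge 3$ be odd, $q=e^{\pi\mathbf{i}/N}$, $a\in\mathbb{C}\setminus\{0\}$, $i\in\{0,1,\dots,N-1\}$, and let $\rho_{a,i}:U_q(sl_2)\to M_N(\mathbb{C})$ be the corresponding semicyclic representation. Then the $R$-matrix satisfies the quantum Yang–Baxter equation in $\rho_{a,i}$: $$(\rho_{a,i}\otimes\rho_{a,i}\otimes\rho_{a,i})\left(R_{12}R_{13}R_{23}-R_{23}R_{13}R_{12}\right)=0.$$
   Context: Throughout, $\mathbf{i}=\sqrt{-1}$, $N\ge3$ is odd, $q=e^{\pi\mathbf{i}/N}$, $[l]=\frac{q^l-q^{-l}}{q-q^{-1}}$, $[0]!=1$, $[n]!=[n][n-1]!$. $U_q(sl_2)$ is the complex algebra generated by $K,K^{-1},E,F$ with $KK^{-1}=K^{-1}K=1$, $KE=q^2EK$, $KF=q^{-2}FK$, $EF-FE=\frac{K-K^{-1}}{q-q^{-1}}$. Semicyclic representations: let $V$ have basis $v_0,\dots,v_{N-1}$. For $m\in\mathbb{Z}$ let $\overline m\in\{0,\dots,N-1\}$ be its remainder mod $N$. For $a\in\mathbb{C}\setminus\{0\}$ and $i\in\{0,\dots,N-1\}$, the representation $\rho_{a,i}:U_q(sl_2)\to \mathrm{End}(V)=M_N(\mathbb{C})$ is given by $\rho_{a,i}(K)v_k=q^{1-N+2(k-i)}v_k$; $\rho_{a,i}(E)v_k=v_{k+1}$ for $k<N-1$ and $\rho_{a,i}(E)v_{N-1}=a v_0$; and for $k\in\{0,\dots,N-1\}$, $\rho_{a,i}(F)v_{\overline{i+k}}=[k][N-k]\,v_{\overline{i+k-1}}$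 if $\overline{i+k}\ne0$, and $\rho_{a,i}(F)v_{\overline{i+k}}=\frac{[k][N-k]}{a}\,v_{\overline{i+k-1}}$ if $\overline{i+k}=0$. $R$-matrix: formally $R=q^{\frac{H\otimes H}{2}}\sum_{l=0}^{N-1}\frac{(q-q^{-1})^l}{[l]!}q^{\frac{l(l-1)}{2}}E^l\otimes F^l$ with $K=q^H$. Its image in $\rho_{a,i}\otimes\rho_{a,i}$ is the operator on $V\otimes V$ obtained by replacing $E,F$ by $\rho_{a,i}(E),\rho_{a,i}(F)$ and letting $q^{\frac{H\otimes H}{2}}$ act by $v_j\otimes v_k\mapsto q^{h_jh_k/2}\,v_j\otimes v_k$ with $h_k=1-N+2(k-i)$. Writing $R=\sum_m s_m\otimes t_m$, set $R_{12}=\sum_m s_m\otimes t_m\otimes1$, $R_{13}=\sum_m s_m\otimes1\otimes t_m$, $R_{23}=\sum_m1\otimes s_m\otimes t_m$; their images are the corresponding operators on $V\otimes V\otimes V$. *)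

theory Defs
  imports Complex_Main "Jordan_Normal_Form.Matrix"
begin

text \<open>The number \<open>q\<^sup>x\<close> for \<open>q = e\<^sup>\<pi>\<^sup>\<i>\<^sup>/\<^sup>N\<close> and a real exponent \<open>x\<close>, with the branch
  \<open>q\<^sup>x = e\<^sup>x\<^sup>\<pi>\<^sup>\<i>\<^sup>/\<^sup>N\<close>.\<close>

definition qpow :: "nat \<Rightarrow> real \<Rightarrow> complex" where
  "qpow N x = exp (complex_of_real (x * pi / real N) * \<i>)"

abbreviation q :: "nat \<Rightarrow> complex" where
  "q N \<equiv> qpow N 1"

definition qnum :: "nat \<Rightarrow> int \<Rightarrow> complex" where
  "qnum N l = (q N powi l - q N powi (- l)) / (q N - inverse (q N))"

primrec qfact :: "nat \<Rightarrow> nat \<Rightarrow> complex" where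
  "qfact N 0 = 1"
| "qfact N (Suc n) = qnum N (int (Suc n)) * qfact N n"

lemma qpow_add: "qpow N (x + y) = qpow N x * qpow N y"
  by (simp add: qpow_def add_divide_distrib distrib_right exp_add)

lemma qpow_0 [simp]: "qpow N 0 = 1"
  by (simp add: qpow_def)

lemma qpow_nonzero [simp]: "qpow N x \<noteq> 0"
  by (simp add: qpow_def)

lemma qpow_minus: "qpow N (- x) = inverse (qpow N x)"
  by (simp add: qpow_def exp_minus)

lemma qpow_of_nat: "qpow N (real n) = q N ^ n"
proof (induction n)
  case (Suc n)
  have "qpow N (real (Suc n)) = qpow N (1 + real n)" by (simp add: add.commute)
  then show ?case using Suc by (simp add: qpow_add)
qed simp

lemma qpow_of_int: "qpow N (of_int m) = q N powi m"
proof (cases "m \<ge> 0")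
  case True
  then obtain n where "m = int n" using nonneg_int_cases by blast
  then show ?thesis by (simp add: qpow_of_nat)
next
  case False
  then obtain n where "m = - int n" by (metis int_cases2 of_nat_0_le_iff)
  then show ?thesis
    by (simp add: qpow_minus qpow_of_nat power_int_minus)
qed

lemma qpow_N: "N > 0 \<Longrightarrow> qpow N (real N) = - 1"
  by (simp add: qpow_def exp_pi_i mult.commute)

datatype uq_gen = K | Kinv | E | F

text \<open>A representation of \<open>U\<^sub>q(sl\<^sub>2)\<close> on \<open>\<complex>\<^sup>n\<close> is given by the images of the generators;
  these are only required to satisfy the defining relations.\<close>

definition uq_sl2_rep :: "nat \<Rightarrow> nat \<Rightarrow> (uq_gen \<Rightarrow> complex mat) \<Rightarrow> bool" where
  "uq_sl2_rep N n \<rho> \<longleftrightarrow>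
     (\<forall>g. \<rho> g \<in> carrier_mat n n) \<and>
     \<rho> K * \<rho> Kinv = 1\<^sub>m n \<and> \<rho> Kinv * \<rho> K = 1\<^sub>m n \<and>
     \<rho> K * \<rho> E = q N powi 2 \<cdot>\<^sub>m (\<rho> E * \<rho> K) \<and>
     \<rho> K * \<rho> F = q N powi (-2) \<cdot>\<^sub>m (\<rho> F * \<rho> K) \<and>
     \<rho> E * \<rho> F - \<rho> F * \<rho> E = (1 / (q N - inverse (q N))) \<cdot>\<^sub>m (\<rho> K - \<rho> Kinv)"

text \<open>The matrix of \<open>v\<^sub>c \<mapsto> w c \<cdot> v\<^bsub>s c\<^esub>\<close>; \<open>v\<^sub>c\<close> is \<open>unit_vec N c\<close> and matrices act on columns.\<close>

definition monomial_mat :: "nat \<Rightarrow> (nat \<Rightarrow> nat) \<Rightarrow> (nat \<Rightarrow> complex) \<Rightarrow> complex mat" where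
  "monomial_mat N s w = mat N N (\<lambda>(r, c). if r = s c then w c else 0)"

text \<open>The eigenvalue of \<open>H\<close> on \<open>v\<^sub>k\<close>, where \<open>K = q\<^sup>H\<close>.\<close>

definition weight :: "nat \<Rightarrow> nat \<Rightarrow> nat \<Rightarrow> int" where
  "weight N i k = 1 - int N + 2 * (int k - int i)"

text \<open>In the last equation \<open>v\<^sub>c = v\<^bsub>i+k mod N\<^esub>\<close> for \<open>k = (c - i) mod N\<close>.\<close>

fun semicyclic :: "nat \<Rightarrow> complex \<Rightarrow> nat \<Rightarrow> uq_gen \<Rightarrow> complex mat" where
  "semicyclic N a i K = monomial_mat N (\<lambda>k. k) (\<lambda>k. q N powi weight N i k)"
| "semicyclic N a i Kinv = monomial_mat N (\<lambda>k. k) (\<lambda>k. q N powi (- weight N i k))"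
| "semicyclic N a i E =
     monomial_mat N (\<lambda>k. if k < N - 1 then k + 1 else 0) (\<lambda>k. if k < N - 1 then 1 else a)"
| "semicyclic N a i F =
     monomial_mat N (\<lambda>c. if c \<noteq> 0 then c - 1 else N - 1)
       (\<lambda>c. let k = (int c - int i) mod int N
            in if c \<noteq> 0 then qnum N k * qnum N (int N - k)
               else qnum N k * qnum N (int N - k) / a)"

lemma monomial_mat_carrier [simp]: "monomial_mat N s w \<in> carrier_mat N N"
  by (simp add: monomial_mat_def)

lemma semicyclic_carrier [simp]: "semicyclic N a i g \<in> carrier_mat N N"
  by (cases g) simp_all

lemma monomial_mat_unit_vec:
  assumes "c < N" "s c < N"
  shows "monomial_mat N s w *\<^sub>v unit_vec N c = w c \<cdot>\<^sub>v unit_vec N (s c)"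
  using assms by (auto simp: monomial_mat_def)

lemma semicyclic_K_action:
  assumes "k < N"
  shows "semicyclic N a i K *\<^sub>v unit_vec N k
           = q N powi (1 - int N + 2 * (int k - int i)) \<cdot>\<^sub>v unit_vec N k"
  using monomial_mat_unit_vec[of k N "\<lambda>k. k"] assms by (simp add: weight_def)

lemma semicyclic_E_action:
  assumes "k < N"
  shows "semicyclic N a i E *\<^sub>v unit_vec N k
           = (if k < N - 1 then unit_vec N (k + 1) else a \<cdot>\<^sub>v unit_vec N 0)"
  unfolding semicyclic.simps
  by (subst monomial_mat_unit_vec) (use assms in auto)

lemma semicyclic_F_action:
  assumes "i < N" "k < N"
  shows "semicyclic N a i F *\<^sub>v unit_vec N ((i + k) mod N)
           = (if (i + k) mod N \<noteq> 0 then qnum N k * qnum N (int N - int k)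
              else qnum N k * qnum N (int N - int k) / a)
             \<cdot>\<^sub>v unit_vec N (nat ((int i + int k - 1) mod int N))"
proof -
  have k: "(int ((i + k) mod N) - int i) mod int N = int k"
  proof -
    have "(int ((i + k) mod N) - int i) mod int N = (int (i + k) - int i) mod int N"
      by (simp add: zmod_int mod_simps)
    then show ?thesis using assms by simp
  qed
  have s: "(if (i + k) mod N \<noteq> 0 then (i + k) mod N - 1 else N - 1)
             = nat ((int i + int k - 1) mod int N)"
  proof -
    define c where "c = (i + k) mod N"
    have c: "c < N" using assms by (simp add: c_def)
    have "(int i + int k - 1) mod int N = (int c - 1) mod int N"
      by (simp add: c_def zmod_int mod_simps)
    also have "\<dots> = (if c \<noteq> 0 then int c - 1 else int N - 1)"
      using c zmod_minus1[of "int N"] by (cases "c = 0") auto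
    finally show ?thesis using c unfolding c_def by auto
  qed
  have "(i + k) mod N < N" using assms by simp
  then have "(i + k) mod N - Suc 0 < N" by linarith
  then show ?thesis
    unfolding semicyclic.simps
    unfolding s[symmetric] using assms k by (subst monomial_mat_unit_vec) (auto simp: Let_def)
qed

lemma monomial_mat_mult:
  assumes "\<And>c. c < N \<Longrightarrow> s' c < N"
  shows "monomial_mat N s w * monomial_mat N s' w' = monomial_mat N (\<lambda>c. s (s' c)) (\<lambda>c. w (s' c) * w' c)"
proof (rule eq_matI)
  fix r c assume "r < dim_row (monomial_mat N (\<lambda>c. s (s' c)) (\<lambda>c. w (s' c) * w' c))"
    "c < dim_col (monomial_mat N (\<lambda>c. s (s' c)) (\<lambda>c. w (s' c) * w' c))"
  then have rc: "r < N" "c < N" by (simp_all add: monomial_mat_def)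
  have "(monomial_mat N s w * monomial_mat N s' w') $$ (r, c)
      = (\<Sum>j = 0..<N. (if r = s j then w j else 0) * (if j = s' c then w' c else 0))"
    using rc by (simp add: monomial_mat_def scalar_prod_def)
  also have "\<dots> = (\<Sum>j = 0..<N. if j = s' c then (if r = s j then w j else 0) * w' c else 0)"
    by (intro sum.cong) auto
  also have "\<dots> = (if r = s (s' c) then w (s' c) else 0) * w' c"
    using assms rc by (simp add: sum.delta)
  finally show "(monomial_mat N s w * monomial_mat N s' w') $$ (r, c)
      = monomial_mat N (\<lambda>c. s (s' c)) (\<lambda>c. w (s' c) * w' c) $$ (r, c)"
    using rc by (simp add: monomial_mat_def)
qed (simp_all add: monomial_mat_def)

lemma monomial_mat_cong:
  assumes "\<And>c. c < N \<Longrightarrow> s c = s' c" "\<And>c. c < N \<Longrightarrow> w c = w' c"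
  shows "monomial_mat N s w = monomial_mat N s' w'"
  using assms by (auto simp: monomial_mat_def intro!: cong_mat)

lemma monomial_mat_smult: "x \<cdot>\<^sub>m monomial_mat N s w = monomial_mat N s (\<lambda>c. x * w c)"
  by (rule eq_matI) (auto simp: monomial_mat_def)

lemma q_nonzero: "q N \<noteq> 0" by simp

lemma q_powi_N: "N > 0 \<Longrightarrow> q N powi int N = - 1"
  using qpow_of_int[of N "int N"] qpow_N[of N] by simp

lemma qnum_minus: "qnum N (- k) = - qnum N k"
  by (simp add: qnum_def minus_divide_left)

lemma qnum_add_N: "N > 0 \<Longrightarrow> qnum N (k + int N) = - qnum N k"
  using q_powi_N[of N]
  by (simp add: qnum_def power_int_add power_int_diff power_int_minus minus_divide_left diff_divide_distrib)

lemma qnum_square_mod: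
  assumes "N > 0"
  shows "qnum N (k mod int N) * qnum N (int N - k mod int N) = (qnum N k)\<^sup>2"
proof -
  have per: "(qnum N (j + int m * int N))\<^sup>2 = (qnum N j)\<^sup>2" for j m
  proof (induction m)
    case (Suc m)
    have "j + int (Suc m) * int N = (j + int m * int N) + int N" by (simp add: algebra_simps)
    then show ?case using Suc by (simp only: qnum_add_N[OF assms] power2_minus)
  qed simp
  have per': "(qnum N (j + m * int N))\<^sup>2 = (qnum N j)\<^sup>2" for j m
  proof (cases "m \<ge> 0")
    case True
    then show ?thesis using per[of j "nat m"] by simp
  next
    case False
    then show ?thesis using per[of "j + m * int N" "nat (- m)"] by simp
  qed
  have "qnum N (int N - k mod int N) = qnum N (k mod int N)"
    using qnum_add_N[OF assms, of "- (k mod int N)"] by (simp add: qnum_minus)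
  moreover have "(qnum N (k mod int N))\<^sup>2 = (qnum N k)\<^sup>2"
    using per'[of "k mod int N" "k div int N"] by simp
  ultimately show ?thesis by (simp add: power2_eq_square)
qed

lemma qnum_square_diff: "(qnum N x)\<^sup>2 - (qnum N (x + 1))\<^sup>2 = - qnum N (2 * x + 1)"
proof -
  define u v Q Q' where uv: "u = q N" "v = inverse u" "Q = u powi x" "Q' = inverse Q"
  have nz: "u \<noteq> 0" "Q \<noteq> 0" by (simp_all add: uv)
  have d: "u powi (2 * x) = Q\<^sup>2"
    using nz by (simp only: uv(3) mult_2 power_int_add power2_eq_square simp_thms)
  have pw: "u powi (x + 1) = u * Q" "u powi (- x) = Q'" "u powi (- (x + 1)) = v * Q'"
    "u powi (2 * x + 1) = u * Q\<^sup>2" "u powi (- (2 * x + 1)) = v * Q'\<^sup>2"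
    unfolding power_int_minus using nz
    by (simp_all add: power_int_add d uv(3)[symmetric]) (simp_all add: uv(2,4) power_inverse)
  have inv: "u * v = 1" using nz by (simp_all add: uv)
  have "(Q - Q')\<^sup>2 - (u * Q - v * Q')\<^sup>2 = - ((u - v) * (u * Q\<^sup>2 - v * Q'\<^sup>2))"
  proof -
    have "(Q - Q')\<^sup>2 - (u * Q - v * Q')\<^sup>2 + (u - v) * (u * Q\<^sup>2 - v * Q'\<^sup>2) = (1 - u * v) * (Q - Q')\<^sup>2"
      by (simp add: algebra_simps power2_eq_square)
    then show ?thesis 
      by (simp only: eq_neg_iff_add_eq_0 inv diff_self mult_zero_left)
  qed
  moreover have "- (d * b) / d\<^sup>2 = - (b / d)" for b d :: complex
    by (cases "d = 0") (simp_all add: power2_eq_square)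
  ultimately have "((Q - Q')\<^sup>2 - (u * Q - v * Q')\<^sup>2) / (u - v)\<^sup>2 = - ((u * Q\<^sup>2 - v * Q'\<^sup>2) / (u - v))"
    by (simp only:)
  then show ?thesis
    unfolding qnum_def uv(1)[symmetric] uv(2)[symmetric] uv(3)[symmetric] pw power_divide
    by (simp only: diff_divide_distrib)
qed

lemma semicyclic_rep:
  assumes "N \<ge> 3" "a \<noteq> 0" "i < N"
  shows "uq_sl2_rep N N (semicyclic N a i)"
proof -
  define \<rho> where "\<rho> = semicyclic N a i"
  have N: "N > 0" using assms by simp
  have per: "q N powi (m + 2 * int N) = q N powi m" for m
  proof -
    have "m + 2 * int N = m + int N + int N" by simp
    then have "q N powi (m + 2 * int N) = q N powi (m + int N + int N)" by (rule arg_cong)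
    then show ?thesis using q_powi_N[OF N] by (simp only: power_int_add q_nonzero simp_thms) simp
  qed
  have per': "q N powi m = q N powi m'" if "m = m' \<or> m + 2 * int N = m' \<or> m = m' + 2 * int N" for m m'
    using that per by metis
  have KK: "\<rho> K * \<rho> Kinv = 1\<^sub>m N" "\<rho> Kinv * \<rho> K = 1\<^sub>m N"
    unfolding \<rho>_def semicyclic.simps
    by (subst monomial_mat_mult; auto simp: monomial_mat_def power_int_minus intro!: eq_matI)+
  have KE: "\<rho> K * \<rho> E = q N powi 2 \<cdot>\<^sub>m (\<rho> E * \<rho> K)"
  proof -
    have "q N powi weight N i (if k < N - 1 then k + 1 else 0) = q N powi (2 + weight N i k)"
      if "k < N" for k
      by (rule per') (use that in \<open>auto simp: weight_def\<close>)
    then show ?thesis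
      unfolding \<rho>_def semicyclic.simps using N
      by (subst (1 2) monomial_mat_mult; auto simp: monomial_mat_def power_int_add intro!: eq_matI)
  qed
  have KF: "\<rho> K * \<rho> F = q N powi (-2) \<cdot>\<^sub>m (\<rho> F * \<rho> K)"
  proof -
    have "q N powi weight N i (if k \<noteq> 0 then k - 1 else N - 1) = q N powi (- 2 + weight N i k)"
      if "k < N" for k
      by (rule per') (use that in \<open>auto simp: weight_def of_nat_diff\<close>)
    then have w: "q N powi weight N i (if 0 < k then k - 1 else N - 1)
        = q N powi (- 2) * q N powi (weight N i k)" if "k < N" for k
      using that by (simp only: power_int_add q_nonzero simp_thms neq0_conv)
    show ?thesis
      unfolding \<rho>_def semicyclic.simps
      by (subst (1 2) monomial_mat_mult; (use N in auto)?; subst monomial_mat_smult;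
          intro monomial_mat_cong; simp only: neq0_conv w mult_ac)
  qed
  have EF: "\<rho> E * \<rho> F - \<rho> F * \<rho> E = (1 / (q N - inverse (q N))) \<cdot>\<^sub>m (\<rho> K - \<rho> Kinv)"
  proof -
    let ?sE = "\<lambda>k. if k < N - 1 then k + 1 else 0" and ?wE = "\<lambda>k. if k < N - 1 then 1 else a"
    let ?sF = "\<lambda>c. if c \<noteq> 0 then c - 1 else N - 1"
    let ?wF = "\<lambda>c. let k = (int c - int i) mod int N in
        if c \<noteq> 0 then qnum N k * qnum N (int N - k) else qnum N k * qnum N (int N - k) / a"
    have s: "?sE (?sF c) = c" "?sF (?sE c) = c" if "c < N" for c
      using that by auto
    have sE: "?sE c < N" and sF: "?sF c < N" if "c < N" for c
      using that by auto
    have 1: "?wE (?sF c) * ?wF c = (qnum N (int c - int i))\<^sup>2" if "c < N" for c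
      using that assms qnum_square_mod[OF N, of "int c - int i"] by (auto simp: Let_def)
    have 2: "?wF (?sE c) * ?wE c = (qnum N (int c - int i + 1))\<^sup>2" if "c < N" for c
    proof (cases "c < N - 1")
      case True
      then show ?thesis
        using qnum_square_mod[OF N, of "int c - int i + 1"] by (simp add: Let_def algebra_simps)
    next
      case False
      then have c: "int c = int N - 1" using that by simp
      have "(int c - int i + 1) mod int N = (- int i) mod int N" unfolding c by simp
      then show ?thesis
        using qnum_square_mod[OF N, of "int c - int i + 1"] False assms by (simp add: Let_def)
    qed
    have 3: "(qnum N (int c - int i))\<^sup>2 - (qnum N (int c - int i + 1))\<^sup>2
      = 1 / (q N - inverse (q N)) * (q N powi weight N i c - q N powi (- weight N i c))" for c
    proof -
      have "weight N i c + int N = 2 * (int c - int i) + 1" by (simp add: weight_def)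
      then have "- qnum N (2 * (int c - int i) + 1) = qnum N (weight N i c)"
        using qnum_add_N[OF N, of "weight N i c"] by simp
      then show ?thesis unfolding qnum_square_diff by (simp add: qnum_def)
    qed
    have EF1: "\<rho> E * \<rho> F = monomial_mat N (\<lambda>c. c) (\<lambda>c. (qnum N (int c - int i))\<^sup>2)"
      unfolding \<rho>_def semicyclic.simps
      by (rule trans[OF monomial_mat_mult monomial_mat_cong])
        (rule sF, assumption, rule s(1), assumption, rule 1, assumption)
    have FE1: "\<rho> F * \<rho> E = monomial_mat N (\<lambda>c. c) (\<lambda>c. (qnum N (int c - int i + 1))\<^sup>2)"
      unfolding \<rho>_def semicyclic.simps
      by (rule trans[OF monomial_mat_mult monomial_mat_cong])
        (rule sE, assumption, rule s(2), assumption, rule 2, assumption)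
    show ?thesis
      unfolding EF1 FE1 unfolding \<rho>_def semicyclic.simps
      by (rule eq_matI) (auto simp: monomial_mat_def 3)
  qed
  show ?thesis
    using KK KE KF EF unfolding uq_sl2_rep_def \<rho>_def by simp
qed

text \<open>Tensor powers of \<open>\<complex>\<^sup>N\<close> carry the lexicographic bases: \<open>v\<^sub>j \<otimes> v\<^sub>k\<close> is basis vector
  \<open>j * N + k\<close>, and \<open>v\<^sub>j \<otimes> v\<^sub>k \<otimes> v\<^sub>l\<close> is basis vector \<open>(j * N + k) * N + l\<close>. With these,
  \<open>A \<otimes> B\<close> is the Kronecker product.\<close>

definition kron :: "complex mat \<Rightarrow> complex mat \<Rightarrow> complex mat" where
  "kron A B = mat (dim_row A * dim_row B) (dim_col A * dim_col B)
     (\<lambda>(r, c). A $$ (r div dim_row B, c div dim_col B) * B $$ (r mod dim_row B, c mod dim_col B))"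

text \<open>For \<open>T = \<Sum>\<^sub>m s\<^sub>m \<otimes> t\<^sub>m\<close> on \<open>\<complex>\<^sup>N \<otimes> \<complex>\<^sup>N\<close> these are \<open>\<Sum>\<^sub>m s\<^sub>m \<otimes> t\<^sub>m \<otimes> 1\<close>, \<open>\<Sum>\<^sub>m s\<^sub>m \<otimes> 1 \<otimes> t\<^sub>m\<close> and
  \<open>\<Sum>\<^sub>m 1 \<otimes> s\<^sub>m \<otimes> t\<^sub>m\<close>. In \<open>leg13\<close> the outer digits of the base-\<open>N\<close> index go through \<open>T\<close>
  and the middle digit is fixed.\<close>

definition leg12 :: "nat \<Rightarrow> complex mat \<Rightarrow> complex mat" where
  "leg12 N T = kron T (1\<^sub>m N)"

definition leg23 :: "nat \<Rightarrow> complex mat \<Rightarrow> complex mat" where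
  "leg23 N T = kron (1\<^sub>m N) T"

definition leg13 :: "nat \<Rightarrow> complex mat \<Rightarrow> complex mat" where
  "leg13 N T = mat (N * N * N) (N * N * N) (\<lambda>(r, c).
     if r div N mod N = c div N mod N
     then T $$ (r div (N * N) * N + r mod N, c div (N * N) * N + c mod N) else 0)"

lemma kron_carrier [simp]:
  "A \<in> carrier_mat n m \<Longrightarrow> B \<in> carrier_mat n' m' \<Longrightarrow> kron A B \<in> carrier_mat (n * n') (m * m')"
  by (auto simp: kron_def)

lemma kron_index:
  assumes "A \<in> carrier_mat n m" "B \<in> carrier_mat n' m'"
    and "j < n" "k < n'" "j' < m" "k' < m'"
  shows "kron A B $$ (j * n' + k, j' * m' + k') = A $$ (j, j') * B $$ (k, k')"
proof -
  have "j * n' + k < n * n'" if "j < n" "k < n'" for j k n n' :: nat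
  proof -
    have "j * n' + k < Suc j * n'" using that by simp
    also have "\<dots> \<le> n * n'" using that by (intro mult_le_mono1) simp
    finally show ?thesis .
  qed
  then show ?thesis using assms by (auto simp: kron_def)
qed

lemma kron_assoc: "kron (kron A B) C = kron A (kron B C)"
proof (rule eq_matI)
  fix r c assume "r < dim_row (kron A (kron B C))" "c < dim_col (kron A (kron B C))"
  then have r: "r < dim_row A * dim_row B * dim_row C" and c: "c < dim_col A * dim_col B * dim_col C"
    by (simp_all add: kron_def mult.assoc)
  have div_lt: "x div n < m" if "x < m * n" for x m n :: nat
    using that by (simp add: less_mult_imp_div_less)
  have dm: "x mod (b * d) div d = x div d mod b" for x b d :: nat
    by (cases "d = 0") (simp_all add: mult.commute[of b d] mod_mult2_eq)
  have mm: "x mod (b * d) mod d = x mod d" for x b d :: nat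
    by (simp add: mod_mod_cancel)
  have pos: "dim_row B > 0" "dim_row C > 0" "dim_col B > 0" "dim_col C > 0"
    using r c by (auto intro!: Nat.gr0I)
  show "kron (kron A B) C $$ (r, c) = kron A (kron B C) $$ (r, c)"
    using r c pos div_lt[OF r] div_lt[OF c]
    by (simp add: kron_def mult.assoc dm mm div_mult2_eq[symmetric] mult.commute[of "dim_row C"]
        mult.commute[of "dim_col C"])
qed (simp_all add: kron_def)

lemma leg13_kron:
  assumes "A \<in> carrier_mat N N" "B \<in> carrier_mat N N"
  shows "leg13 N (kron A B) = kron (kron A (1\<^sub>m N)) B"
proof (rule eq_matI)
  fix r c assume "r < dim_row (kron (kron A (1\<^sub>m N)) B)" "c < dim_col (kron (kron A (1\<^sub>m N)) B)"
  then have r: "r < N * N * N" and c: "c < N * N * N"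
    using assms by (simp_all add: kron_def)
  have N: "N > 0" using r by (auto intro!: Nat.gr0I)
  have d: "x div (N * N) < N" "x div N < N * N" if "x < N * N * N" for x
    using that by (simp_all add: less_mult_imp_div_less mult.assoc)
  have k: "kron (kron A (1\<^sub>m N)) B $$ (r, c)
      = kron A (1\<^sub>m N) $$ (r div N, c div N) * B $$ (r mod N, c mod N)"
    using r c assms by (subst kron_def) (simp add: kron_def)
  have k': "kron A (1\<^sub>m N) $$ (r div N, c div N)
      = A $$ (r div (N * N), c div (N * N)) * 1\<^sub>m N $$ (r div N mod N, c div N mod N)"
    using d[OF r] d[OF c] assms by (simp add: kron_def div_mult2_eq)
  show "leg13 N (kron A B) $$ (r, c) = kron (kron A (1\<^sub>m N)) B $$ (r, c)"
    unfolding k k' using r c N d[OF r] d[OF c]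
    by (auto simp: leg13_def kron_index[OF assms])
qed (use assms in \<open>simp_all add: leg13_def kron_def\<close>)

lemma leg13_add:
  assumes "S \<in> carrier_mat (N * N) (N * N)" "T \<in> carrier_mat (N * N) (N * N)"
  shows "leg13 N (S + T) = leg13 N S + leg13 N T"
proof -
  have "x div (N * N) * N + x mod N < N * N" if "x < N * N * N" for x
  proof -
    have "N > 0" using that by (auto intro!: Nat.gr0I)
    then have "x div (N * N) * N + x mod N < Suc (x div (N * N)) * N" by simp
    also have "\<dots> \<le> N * N"
      using that by (intro mult_le_mono1) (simp add: less_mult_imp_div_less mult.assoc Suc_le_eq)
    finally show ?thesis .
  qed
  then show ?thesis using assms by (auto simp: leg13_def intro!: eq_matI)
qed

text \<open>\<open>q\<^bsup>H\<otimes>H/2\<^esup>\<close> acts by \<open>v\<^sub>j \<otimes> v\<^sub>k \<mapsto> q\<^bsup>h j * h k / 2\<^esup> v\<^sub>j \<otimes> v\<^sub>k\<close>, where \<open>h = weight N i\<close>.\<close>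

definition qHH :: "nat \<Rightarrow> nat \<Rightarrow> complex mat" where
  "qHH N i = mat (N * N) (N * N) (\<lambda>(r, c).
     if r = c then qpow N (of_int (weight N i (r div N) * weight N i (r mod N)) / 2) else 0)"

text \<open>The exponent \<open>l (l - 1) div 2\<close> is exact.\<close>

definition R_sum :: "nat \<Rightarrow> (uq_gen \<Rightarrow> complex mat) \<Rightarrow> complex mat" where
  "R_sum N \<rho> = mat (N * N) (N * N) (\<lambda>(r, c).
     \<Sum>l = 0..N - 1. (q N - inverse (q N)) ^ l / qfact N l * q N ^ (l * (l - 1) div 2)
        * kron (\<rho> E ^\<^sub>m l) (\<rho> F ^\<^sub>m l) $$ (r, c))"

definition R_matrix :: "nat \<Rightarrow> complex \<Rightarrow> nat \<Rightarrow> complex mat" where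
  "R_matrix N a i = qHH N i * R_sum N (semicyclic N a i)"

end

theory Submission
  imports Defs
begin

text \<open>Put \<open>v\<^bsub>m + N\<^esub> = a v\<^sub>m\<close>, so that \<open>v\<^sub>m\<close> is defined for all \<open>m \<in> \<int>\<close>, and count \<open>m\<close> from \<open>i\<close>.
  Then the case distinctions in the semicyclic representation disappear: for \<open>w\<^sub>y = v\<^bsub>y + i\<^esub>\<close>,
  \<open>E w\<^sub>y = w\<^bsub>y + 1\<^esub>\<close> and \<open>F w\<^sub>y = [y]\<^sup>2 w\<^bsub>y - 1\<^esub>\<close>. Since \<open>N\<close> is odd, \<open>h = 2 (y - p)\<close> with
  \<open>p = (N - 1) / 2\<close> is even, so \<open>q\<^bsup>H\<otimes>H/2\<^esup>\<close> multiplies \<open>w\<^sub>x \<otimes> w\<^sub>y\<close> by \<open>u\<^bsup>(x - p) (y - p)\<^esup>\<close> for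
  \<open>u = q\<^sup>2\<close>. This depends on \<open>x\<close> and \<open>y\<close> modulo \<open>N\<close> only, hence is consistent with
  \<open>v\<^bsub>m + N\<^esub> = a v\<^sub>m\<close>. The Yang-Baxter equation becomes an identity for operators on functions on
  \<open>\<int>\<^sup>3\<close> in which neither \<open>a\<close> nor \<open>i\<close> occurs.

  The identity follows the usual argument for quasitriangular Hopf algebras, but only the coproduct
  of \<open>E\<close> enters. Write \<open>\<Delta>(E) = E \<otimes> K + 1 \<otimes> E\<close> and \<open>\<Delta>\<^sup>o\<^sup>p(E) = K \<otimes> E + E \<otimes> 1\<close>.

  \<^item> The relation \<open>R \<Delta>(E) = \<Delta>\<^sup>o\<^sup>p(E) R\<close> holds in spite of the truncation of \<open>R\<close> at \<open>E\<^sup>N\<close>, which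
    is not zero here (\<open>R_op_coprod_E\<close>). The term which the truncation cuts off has the factor
    \<open>F\<^bsup>N - 1\<^esup>\<close>, and this operator kills every \<open>w\<^sub>y\<close> but those of extreme weight, on which the
    remaining factor vanishes.
  \<^item> By the \<open>q\<close>-Pascal rule, the part of \<open>R\<^sub>1\<^sub>3 R\<^sub>2\<^sub>3\<close> that contains \<open>F\<^sup>t\<close> in the third leg is
    a factor depending on the total weight of the first two legs, times a multiple of
    \<open>\<Delta>(E)\<^sup>t\<close> (\<open>R23_R13_op\<close>, \<open>coprod_E_divpow_Suc\<close>). In \<open>R\<^sub>2\<^sub>3 R\<^sub>1\<^sub>3\<close> it is the same with
    \<open>\<Delta>\<^sup>o\<^sup>p\<close>. Here \<open>t < N\<close>, because \<open>F\<^sup>N = 0\<close>.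
  \<^item> So moving \<open>R\<^sub>1\<^sub>2\<close> through each of these terms turns \<open>R\<^sub>1\<^sub>2 R\<^sub>1\<^sub>3 R\<^sub>2\<^sub>3\<close> into
    \<open>R\<^sub>2\<^sub>3 R\<^sub>1\<^sub>3 R\<^sub>1\<^sub>2\<close> (\<open>yang_baxter_op\<close>).

  A matrix \<open>A\<close> is described by what it does to the families \<open>w\<close>: each coordinate of \<open>w\<close> is a
  function of the index, and the action of \<open>A\<close> is an operator on such functions (\<open>realizes\<close>).
  Passing from matrices to these operators reverses products, which is why the operators below
  appear in the opposite order.\<close>

section \<open>Matrices acting on families of vectors\<close>

lemma sum_lessThan_triangle:
  fixes f :: "nat \<Rightarrow> nat \<Rightarrow> 'a::comm_monoid_add"
  assumes "\<And>m n. m + n \<ge> N \<Longrightarrow> f m n = 0"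
  shows "(\<Sum>m<N. \<Sum>n<N. f m n) = (\<Sum>t<N. \<Sum>m\<le>t. f m (t - m))"
proof -
  have "(\<Sum>m<N. \<Sum>n<N. f m n) = (\<Sum>(m, n)\<in>{..<N} \<times> {..<N}. f m n)"
    by (simp add: sum.cartesian_product)
  also have "\<dots> = (\<Sum>(m, n)\<in>{(m, n). m + n < N}. f m n)"
    by (rule sum.mono_neutral_right) (auto intro: assms)
  also have "\<dots> = (\<Sum>t<N. \<Sum>m\<le>t. f m (t - m))"
    by (rule sum.triangle_reindex)
  finally show ?thesis .
qed

lemma sum_digits:
  fixes g :: "nat \<Rightarrow> 'a::comm_monoid_add"
  shows "(\<Sum>c<m * n. g c) = (\<Sum>j<m. \<Sum>k<n. g (j * n + k))"
proof -
  have "(\<Sum>c<m * n. g c) = (\<Sum>j<m. sum g {j * n..<j * n + n})"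
    by (rule sum.nat_group[symmetric])
  also have "\<dots> = (\<Sum>j<m. \<Sum>k<n. g (j * n + k))"
    by (subst sum.atLeastLessThan_shift_0) (simp add: lessThan_atLeast0)
  finally show ?thesis .
qed

lemma digits_less:
  fixes j k m n :: nat
  assumes "j < m" "k < n"
  shows "j * n + k < m * n"
proof -
  have "j * n + k < Suc j * n" using assms by simp
  also have "\<dots> \<le> m * n" using assms by (intro mult_le_mono1) simp
  finally show ?thesis .
qed

text \<open>The family \<open>W\<close> assigns to each index \<open>w\<close> a vector with coordinates \<open>W w r\<close>. If
  \<open>A W\<^sub>w = \<Sum>\<^sub>w\<^sub>' k(w, w') W\<^sub>w\<^sub>'\<close>, then each coordinate function \<open>h\<close> of \<open>W\<close> is mapped to
  \<open>w \<mapsto> \<Sum>\<^sub>w\<^sub>' k(w, w') h(w')\<close>; this operator, extended to all functions, is \<open>f\<close>. It is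
  the same for every coordinate \<open>r\<close>, so identities between matrices follow from identities between
  operators that do not mention \<open>W\<close>.\<close>

definition realizes ::
    "nat \<Rightarrow> ('p \<Rightarrow> nat \<Rightarrow> complex) \<Rightarrow> complex mat \<Rightarrow> (('p \<Rightarrow> complex) \<Rightarrow> 'p \<Rightarrow> complex) \<Rightarrow> bool" where
  "realizes n W A f \<longleftrightarrow> A \<in> carrier_mat n n \<and>
     (\<forall>w. \<forall>r<n. (\<Sum>c<n. A $$ (r, c) * W w c) = f (\<lambda>w. W w r) w)"

lemma realizes_one: "realizes n W (1\<^sub>m n) (\<lambda>f. f)"
proof -
  have "(\<Sum>c<n. 1\<^sub>m n $$ (r, c) * W w c) = W w r" if "r < n" for r w
  proof -
    have "(\<Sum>c<n. 1\<^sub>m n $$ (r, c) * W w c) = (\<Sum>c<n. if c = r then W w c else 0)"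
      using that by (intro sum.cong) auto
    then show ?thesis using that by simp
  qed
  then show ?thesis by (simp add: realizes_def)
qed

text \<open>The order is reversed: \<open>B W\<^sub>w\<close> is a combination of members of the family, and \<open>A\<close> acts on each
  of these, so that \<open>f\<close> is applied inside \<open>g\<close>.\<close>

lemma realizes_mult:
  assumes A: "realizes n W A f" and B: "realizes n W B g"
    and g: "\<And>k h. g (\<lambda>w. \<Sum>c<n. k c * h c w) = (\<lambda>w. \<Sum>c<n. k c * g (h c) w)"
  shows "realizes n W (A * B) (\<lambda>h. g (f h))"
proof -
  have c: "A \<in> carrier_mat n n" "B \<in> carrier_mat n n" using A B by (auto simp: realizes_def)
  have "(\<Sum>c<n. (A * B) $$ (r, c) * W w c) = g (f (\<lambda>w. W w r)) w" if r: "r < n" for r w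
  proof -
    have "(\<Sum>c<n. (A * B) $$ (r, c) * W w c) = (\<Sum>c<n. \<Sum>d<n. A $$ (r, d) * (B $$ (d, c) * W w c))"
      using r c by (intro sum.cong refl) (simp add: scalar_prod_def lessThan_atLeast0 sum_distrib_right mult.assoc)
    also have "\<dots> = (\<Sum>d<n. A $$ (r, d) * (\<Sum>c<n. B $$ (d, c) * W w c))"
      unfolding sum_distrib_left by (rule sum.swap)
    also have "\<dots> = (\<Sum>d<n. A $$ (r, d) * g (\<lambda>w. W w d) w)"
      using B by (intro sum.cong refl) (simp add: realizes_def)
    also have "\<dots> = g (\<lambda>w. \<Sum>d<n. A $$ (r, d) * W w d) w" by (simp only: g)
    also have "(\<lambda>w. \<Sum>d<n. A $$ (r, d) * W w d) = f (\<lambda>w. W w r)"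
      using A r by (auto simp: realizes_def)
    finally show ?thesis .
  qed
  then show ?thesis using c by (simp add: realizes_def)
qed

lemma realizes_unique:
  assumes A: "realizes n W A f" and B: "realizes n W B f"
    and basis: "\<And>c. c < n \<Longrightarrow> \<exists>w. \<forall>d<n. W w d = (if d = c then 1 else 0)"
  shows "A = B"
proof (rule eq_matI)
  have c: "A \<in> carrier_mat n n" "B \<in> carrier_mat n n" using A B by (auto simp: realizes_def)
  fix r c assume "r < dim_row B" "c < dim_col B"
  then have rc: "r < n" "c < n" using c by auto
  obtain w where w: "\<And>d. d < n \<Longrightarrow> W w d = (if d = c then 1 else 0)" using basis[OF rc(2)] by auto
  have "M $$ (r, c) = (\<Sum>d<n. M $$ (r, d) * W w d)" for M :: "complex mat"
  proof -
    have "(\<Sum>d<n. M $$ (r, d) * W w d) = (\<Sum>d<n. if d = c then M $$ (r, d) else 0)"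
      by (intro sum.cong) (auto simp: w)
    then show ?thesis using rc by simp
  qed
  then show "A $$ (r, c) = B $$ (r, c)"
    using A B rc by (simp add: realizes_def)
qed (use A B in \<open>auto simp: realizes_def\<close>)

section \<open>The scalars at an odd level\<close>

locale odd_root_of_unity =
  fixes N :: nat
  assumes N_ge_3: "N \<ge> 3" and odd_N: "odd N"
begin

text \<open>The weights are \<open>2 (y - p)\<close>, the highest one is \<open>2 p\<close>; all are even because \<open>N\<close> is odd.\<close>

definition p :: int where
  "p = (int N - 1) div 2"

definition u :: "int \<Rightarrow> complex" where
  "u k = q N powi (2 * k)"

text \<open>The scalar in \<open>F\<^sup>l w\<^sub>y = lowering l y \<cdot> w\<^bsub>y - l\<^esub>\<close>.\<close>

definition lowering :: "nat \<Rightarrow> int \<Rightarrow> complex" where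
  "lowering l y = (\<Prod>s<l. (qnum N (y - int s))\<^sup>2)"

text \<open>The coefficient of \<open>E\<^sup>l \<otimes> F\<^sup>l\<close> in \<open>R\<close>. The value \<open>0\<close> from \<open>N\<close> on records the truncation, so
  that coefficients can be compared after an index shift without treating the last one apart.\<close>

definition R_coeff :: "nat \<Rightarrow> complex" where
  "R_coeff l = (if l < N
     then (q N - inverse (q N)) ^ l / qfact N l * q N ^ (l * (l - 1) div 2) else 0)"

text \<open>The constant with \<open>R_coeff l (1 - u\<^bsup>-l\<^esup>) = divpow_scale \<cdot> R_coeff (l - 1)\<close> for
  \<open>0 < l < N\<close>. Thus \<open>R_coeff l\<close> is \<open>divpow_scale\<^sup>l\<close> divided by a \<open>u\<^bsup>-1\<^esup>\<close>-factorial, and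
  \<open>\<Sum>\<^sub>l R_coeff l X\<^sup>l\<close> is a truncated \<open>q\<close>-exponential series.\<close>

definition divpow_scale :: complex where
  "divpow_scale = (q N - inverse (q N))\<^sup>2 / q N"

lemma N_pos: "N > 0"
  using N_ge_3 by simp

lemma two_p: "2 * p = int N - 1"
  using odd_N unfolding p_def by simp

lemma u_add: "u (j + k) = u j * u k"
  by (simp add: u_def distrib_left power_int_add)

lemma u_0 [simp]: "u 0 = 1"
  by (simp add: u_def)

lemma u_N: "u (int N) = 1"
proof -
  have "u (int N) = q N powi (int N + int N)" by (simp add: u_def)
  also have "\<dots> = 1" using q_powi_N[OF N_pos] by (simp only: power_int_add q_nonzero simp_thms) simp
  finally show ?thesis .
qed

lemma u_mult_N: "u (int N * k) = 1"
proof -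
  have "u (int N * k) = u (int N) powi k"
    by (simp add: u_def power_int_mult mult.assoc)
  then show ?thesis by (simp add: u_N)
qed

lemma u_cong:
  assumes "j mod int N = k mod int N"
  shows "u j = u k"
proof -
  obtain m where "j = k + int N * m"
    using assms by (metis mod_eqE)
  then show ?thesis by (simp add: u_add u_mult_N)
qed

lemma u_minus_p: "u (- p) = - q N"
proof -
  have "u (- p) = q N powi (1 - int N)" using two_p by (simp add: u_def)
  also have "\<dots> = - q N" using q_powi_N[OF N_pos] by (simp add: power_int_diff)
  finally show ?thesis .
qed

lemma u_p: "u p = - inverse (q N)"
proof -
  have "u p * u (- p) = 1" by (simp flip: u_add)
  then have "u p * q N = - 1" by (simp add: u_minus_p minus_equation_iff)
  then show ?thesis by (simp add: field_simps)
qed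

lemma u_neq_1:
  assumes "0 < t" "t < N"
  shows "u (- int t) \<noteq> 1"
proof
  assume "u (- int t) = 1"
  then have "qpow N (of_int (2 * (- int t))) = 1" by (simp only: u_def qpow_of_int)
  then have "cos (of_int (2 * (- int t)) * pi / real N) = 1"
    using Re_exp[of "complex_of_real (of_int (2 * (- int t)) * pi / real N) * \<i>"]
    by (simp add: qpow_def)
  then obtain n :: int where "of_int (2 * (- int t)) * pi / real N = of_int n * 2 * pi"
    using cos_one_2pi_int by blast
  then have "pi * real_of_int (- int t) = pi * real_of_int (n * int N)" using N_pos by (simp add: field_simps)
  then have "real_of_int (- int t) = real_of_int (n * int N)" by (simp only: mult_cancel_left pi_neq_zero simp_thms)
  then have "- int t = n * int N" by (simp only: of_int_eq_iff)
  then have "int N dvd int t" by (metis dvd_minus_iff dvd_triv_right)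
  then show False using assms by (simp add: nat_dvd_not_less)
qed

lemma q_minus_inverse_neq_0: "q N - inverse (q N) \<noteq> 0"
proof
  assume "q N - inverse (q N) = 0"
  then have "inverse (q N) * inverse (q N) = 1" by (metis eq_iff_diff_eq_0 q_nonzero right_inverse)
  then show False using u_neq_1[of 1] N_ge_3
    by (simp add: u_def power_int_minus power2_eq_square)
qed

lemma qnum_square: "(q N - inverse (q N))\<^sup>2 * (qnum N k)\<^sup>2 = u k - 2 + u (- k)"
proof -
  have "u k = (q N powi k)\<^sup>2" "u (- k) = (q N powi (- k))\<^sup>2"
    unfolding u_def mult_2 power2_eq_square by (simp_all only: power_int_add q_nonzero simp_thms)
  moreover have "q N powi k * q N powi (- k) = 1"
    by (simp add: power_int_minus)
  moreover have "(q N - inverse (q N)) * qnum N k = q N powi k - q N powi (- k)"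
    using q_minus_inverse_neq_0 by (simp add: qnum_def)
  ultimately show ?thesis
    by (simp flip: power_mult_distrib) (simp add: power2_diff)
qed

lemma qnum_multiple_N: "qnum N (int N * k) = 0"
proof -
  have "(qnum N (int N * k))\<^sup>2 = 0"
    using qnum_square[of "int N * k"] q_minus_inverse_neq_0 u_mult_N[of k] u_mult_N[of "- k"] by simp
  then show ?thesis by simp
qed

lemma qnum_neq_0:
  assumes "0 < t" "t < N"
  shows "qnum N (int t) \<noteq> 0"
proof
  assume "qnum N (int t) = 0"
  then have "q N powi int t = q N powi (- int t)" using q_minus_inverse_neq_0 by (simp add: qnum_def)
  then have "q N powi (- int t) * q N powi (- int t) = 1" 
    using power_int_add[of "q N" "int t" "- int t"] by simp
  then show False using u_neq_1[OF assms] by (simp only: u_def mult_2 power_int_add q_nonzero simp_thms)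
qed

lemma lowering_0 [simp]: "lowering 0 y = 1"
  by (simp add: lowering_def)

lemma lowering_Suc: "lowering (Suc l) y = lowering l y * (qnum N (y - int l))\<^sup>2"
  by (simp add: lowering_def)

lemma lowering_add: "lowering (m + n) y = lowering m y * lowering n (y - int m)"
  by (induction n) (simp_all add: lowering_Suc algebra_simps)

lemma lowering_Suc_shift: "lowering (Suc l) (y + 1) = (qnum N (y + 1))\<^sup>2 * lowering l y"
  using lowering_add[of 1 l "y + 1"] lowering_Suc[of 0 "y + 1"] by simp

text \<open>Lowering \<open>w\<^sub>y\<close> passes the factor \<open>[0]\<close> after the largest multiple of \<open>N\<close> that is at
  most \<open>y\<close>.\<close>

lemma lowering_eq_0:
  assumes "y mod int N < int l"
  shows "lowering l y = 0"
proof -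
  let ?s = "nat (y mod int N)"
  have s: "int ?s = y mod int N" using N_pos by simp
  then have "?s < l" using assms by linarith
  moreover have "y - int ?s = int N * (y div int N)" unfolding s by (simp add: minus_mod_eq_mult_div)
  then have "qnum N (y - int ?s) = 0" by (simp only: qnum_multiple_N)
  ultimately show ?thesis unfolding lowering_def by (auto intro!: prod_zero bexI[of _ ?s])
qed

lemma lowering_ge_N: "l \<ge> N \<Longrightarrow> lowering l y = 0"
  using N_pos by (intro lowering_eq_0 less_le_trans[OF pos_mod_bound]) auto

lemma R_coeff_rec:
  assumes "Suc l < N"
  shows "R_coeff (Suc l) * (1 - u (- int (Suc l))) = divpow_scale * R_coeff l"
proof -
  let ?d = "q N - inverse (q N)"
  let ?n = "qnum N (int (Suc l))"
  have "Suc l * l div 2 = l * (l - 1) div 2 + l"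
    by (cases l) (simp_all add: algebra_simps)
  then have tri: "q N ^ (Suc l * (Suc l - 1) div 2) = q N ^ (l * (l - 1) div 2) * q N ^ l"
    by (simp only: diff_Suc_1 power_add)
  have "q N ^ Suc l * (1 - u (- int (Suc l))) = q N powi int (Suc l) * (1 - q N powi (- int (Suc l) + - int (Suc l)))"
    by (simp only: u_def mult_2 power_int_of_nat)
  also have "\<dots> = q N powi int (Suc l) - q N powi (- int (Suc l))"
    by (simp only: right_diff_distrib mult_1_right flip: power_int_add[OF disjI1[OF q_nonzero]]) simp
  also have "\<dots> = ?d * ?n" using q_minus_inverse_neq_0 by (simp add: qnum_def)
  finally have *: "q N ^ l * (1 - u (- int (Suc l))) = ?d * ?n / q N"
    by (simp add: field_simps)
  have "R_coeff (Suc l) * (1 - u (- int (Suc l)))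
      = ?d ^ Suc l / (?n * qfact N l) * q N ^ (l * (l - 1) div 2) * (q N ^ l * (1 - u (- int (Suc l))))"
    using assms unfolding R_coeff_def tri by (simp del: power_Suc of_nat_Suc mult_Suc)
  also have "\<dots> = divpow_scale * R_coeff l"
    unfolding * using assms qnum_neq_0[OF _ assms]
    by (simp add: R_coeff_def divpow_scale_def power2_eq_square mult_ac)
  finally show ?thesis .
qed

section \<open>The operator \<open>R\<close> and the coproduct of \<open>E\<close>\<close>

text \<open>The action of \<open>R\<close> on the family \<open>w\<^sub>x \<otimes> w\<^sub>y\<close>.\<close>

definition R_op :: "(int \<times> int \<Rightarrow> complex) \<Rightarrow> int \<times> int \<Rightarrow> complex" where
  "R_op f = (\<lambda>(x, y). \<Sum>l<N. R_coeff l * lowering l y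
     * u ((x + int l - p) * (y - int l - p)) * f (x + int l, y - int l))"

text \<open>The action of \<open>\<Delta>(E) = E \<otimes> K + 1 \<otimes> E\<close>; conjugation with \<open>flip\<close> gives the opposite
  coproduct.\<close>

definition coprod_E :: "(int \<times> int \<Rightarrow> complex) \<Rightarrow> int \<times> int \<Rightarrow> complex" where
  "coprod_E f = (\<lambda>(x, y). u (y - p) * f (x + 1, y) + f (x, y + 1))"

definition flip :: "(int \<times> int \<Rightarrow> complex) \<Rightarrow> int \<times> int \<Rightarrow> complex" where
  "flip f = (\<lambda>(x, y). f (y, x))"

abbreviation coprod_E_op :: "(int \<times> int \<Rightarrow> complex) \<Rightarrow> int \<times> int \<Rightarrow> complex" where
  "coprod_E_op f \<equiv> flip (coprod_E (flip f))"

lemma flip_flip [simp]: "flip (flip f) = f"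
  by (auto simp: flip_def)

text \<open>The coefficient of \<open>E\<^bsup>l + 1\<^esup> \<otimes> F\<^sup>l\<close> in \<open>R \<Delta>(E) = \<Delta>\<^sup>o\<^sup>p(E) R\<close>. The first summand comes from
  \<open>E \<otimes> K\<close> and \<open>E \<otimes> 1\<close>, the second from the commutator of \<open>E\<close> and \<open>F\<^bsup>l + 1\<^esup>\<close> in the second leg.
  For \<open>l + 1 < N\<close> both are multiples of \<open>(1 - u\<^bsup>-(l + 1)\<^esup>) (u\<^bsup>y + 1\<^esup> - u\<^bsup>-(y - l)\<^esup>)\<close>, by the recurrence
  for the coefficients and by the formula for \<open>[y + 1]\<^sup>2 - [y - l]\<^sup>2\<close>. For \<open>l = N - 1\<close> the second is
  cut off and the first has to vanish by itself.\<close>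

lemma intertwining_coefficients:
  assumes "l < N"
  shows "R_coeff l * lowering l y * (u (y - p) - u (- (y - int l - p)))
    + R_coeff (Suc l) * (lowering (Suc l) (y + 1) - lowering (Suc l) y) = 0"
proof (cases "Suc l < N")
  case True
  let ?d = "(q N - inverse (q N))\<^sup>2"
  have rearrange: "c * e * L * (- A - - B) = - c * (L * (e * (A - B)))" for c e L A B :: complex
    by (simp add: algebra_simps)
  have dk: "divpow_scale * q N = ?d" by (simp add: divpow_scale_def)
  have e1: "q N * u (y - p) = - u (y + 1)"
  proof -
    have "u (y + 1) = u y * (q N * q N)" by (simp only: u_add) (simp add: u_def power2_eq_square)
    then show ?thesis using u_add[of y "- p"] by (simp add: u_minus_p)
  qed
  have e2: "q N * u (- (y - int l - p)) = - u (- (y - int l))"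
    using u_add[of "- (y - int l)" p] by (simp add: u_p algebra_simps)
  have "?d * (qnum N (y + 1))\<^sup>2 - ?d * (qnum N (y - int l))\<^sup>2
      = (1 - u (- int (Suc l))) * (u (y + 1) - u (- (y - int l)))"
  proof -
    have "u (y - int l) = u (y + 1) * u (- int (Suc l))"
      "u (- (y + 1)) = u (- (y - int l)) * u (- int (Suc l))"
      by (simp_all flip: u_add)
    then show ?thesis unfolding qnum_square by (simp add: algebra_simps)
  qed
  moreover have "?d * (lowering (Suc l) (y + 1) - lowering (Suc l) y)
      = lowering l y * (?d * (qnum N (y + 1))\<^sup>2 - ?d * (qnum N (y - int l))\<^sup>2)"
    unfolding lowering_Suc_shift[of l y] lowering_Suc[of l y] by (simp only: right_diff_distrib mult_ac)
  ultimately have "?d * (lowering (Suc l) (y + 1) - lowering (Suc l) y)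
      = lowering l y * ((1 - u (- int (Suc l))) * (u (y + 1) - u (- (y - int l))))"
    by (simp only:)
  moreover have "divpow_scale * q N * (R_coeff l * lowering l y * (u (y - p) - u (- (y - int l - p))))
      = divpow_scale * R_coeff l * lowering l y * (q N * u (y - p) - q N * u (- (y - int l - p)))"
    by (simp only: right_diff_distrib mult_ac)
  then have "?d * (R_coeff l * lowering l y * (u (y - p) - u (- (y - int l - p))))
      = - R_coeff (Suc l) * (lowering l y * ((1 - u (- int (Suc l))) * (u (y + 1) - u (- (y - int l)))))"
    unfolding e1 e2 dk R_coeff_rec[OF True, symmetric] by (simp only: rearrange)
  ultimately have "?d * (R_coeff l * lowering l y * (u (y - p) - u (- (y - int l - p)))
    + R_coeff (Suc l) * (lowering (Suc l) (y + 1) - lowering (Suc l) y)) = 0"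
    by (simp add: distrib_left mult.left_commute[of ?d "R_coeff (Suc l)"])
  then show ?thesis using q_minus_inverse_neq_0 by simp
next
  case False
  then have l: "l = N - 1" using assms by simp
  have "lowering l y * (u (y - p) - u (- (y - int l - p))) = 0"
  proof (cases "y mod int N < int l")
    case True
    then show ?thesis by (simp add: lowering_eq_0)
  next
    case F: False
    have "y mod int N < int N" using N_pos by simp
    \<comment> \<open>Only \<open>y \<equiv> -1\<close> survives: there \<open>F\<^bsup>N - 1\<^esup>\<close> leads from the highest weight to the lowest one,
      and the two powers of \<open>u\<close> agree because \<open>N\<close> divides \<open>2 y + 2\<close>.\<close>
    moreover have "int l = int N - 1" using l N_pos by (simp add: of_nat_diff)
    ultimately have ym: "y mod int N = int N - 1" using F by linarith
    have "(y - p - - (y - int l - p)) = 2 * y + 2 - 2 * int N"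
      using two_p l N_pos by (simp add: of_nat_diff)
    also have "\<dots> = 2 * (y - (int N - 1))" by simp
    also have "int N dvd \<dots>" using ym by (metis dvd_mult mod_eq_dvd_iff mod_mod_trivial)
    finally have "u (y - p) = u (- (y - int l - p))" by (intro u_cong) (simp only: mod_eq_dvd_iff)
    then show ?thesis by simp
  qed
  then show ?thesis using False by (simp add: R_coeff_def mult.assoc)
qed

text \<open>The intertwining relation \<open>R \<Delta>(E) = \<Delta>\<^sup>o\<^sup>p(E) R\<close>. Comparison of the coefficients of
  \<open>f (x + l, y + 1 - l)\<close> reduces it to the previous lemma.\<close>

lemma R_op_coprod_E: "coprod_E (R_op f) = R_op (coprod_E_op f)"
proof (rule ext, clarify)
  fix x y
  let ?c = R_coeff
  let ?Q = "\<lambda>l. u ((x + int l - p) * (y + 1 - int l - p))"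
  let ?f = "\<lambda>l. f (x + int l, y + 1 - int l)"
  have cN: "?c N = 0" by (simp add: R_coeff_def)
  have Q1: "u ((x + int l - p) * (y - int l - p)) = ?Q (Suc l) * u (- (y - int l - p))" for l
    by (simp flip: u_add add: algebra_simps)
  have Q2: "u ((x + int l - p) * (y - int l - p)) * u (x + int l - p) = ?Q l" for l
    by (simp flip: u_add add: algebra_simps)
  have "coprod_E (R_op f) (x, y) =
      (\<Sum>l<N. ?c l * lowering l y * u (y - p) * ?Q (Suc l) * ?f (Suc l))
      + (\<Sum>l<N. ?c l * lowering l (y + 1) * ?Q l * ?f l)"
    by (simp add: coprod_E_def R_op_def sum_distrib_left algebra_simps)
  also have "(\<Sum>l<N. ?c l * lowering l (y + 1) * ?Q l * ?f l)
      = ?c 0 * ?Q 0 * ?f 0 + (\<Sum>l<N. ?c (Suc l) * lowering (Suc l) (y + 1) * ?Q (Suc l) * ?f (Suc l))"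
    using sum.lessThan_Suc_shift[of "\<lambda>l. ?c l * lowering l (y + 1) * ?Q l * ?f l" N]
    by (simp only: sum.lessThan_Suc cN) simp
  finally have L: "coprod_E (R_op f) (x, y) =
      (\<Sum>l<N. ?c l * lowering l y * u (y - p) * ?Q (Suc l) * ?f (Suc l))
      + (?c 0 * ?Q 0 * ?f 0
         + (\<Sum>l<N. ?c (Suc l) * lowering (Suc l) (y + 1) * ?Q (Suc l) * ?f (Suc l)))" .
  have "R_op (coprod_E_op f) (x, y) = (\<Sum>l<N. ?c l * lowering l y * u (- (y - int l - p)) * ?Q (Suc l) * ?f (Suc l))
      + (\<Sum>l<N. ?c l * lowering l y * ?Q l * ?f l)"
    unfolding R_op_def flip_def coprod_E_def prod.case sum.distrib[symmetric]
    by (intro sum.cong refl) (simp add: Q1 flip: Q2, simp add: algebra_simps Q1)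
  also have "(\<Sum>l<N. ?c l * lowering l y * ?Q l * ?f l)
      = ?c 0 * ?Q 0 * ?f 0 + (\<Sum>l<N. ?c (Suc l) * lowering (Suc l) y * ?Q (Suc l) * ?f (Suc l))"
    using sum.lessThan_Suc_shift[of "\<lambda>l. ?c l * lowering l y * ?Q l * ?f l" N]
    by (simp only: sum.lessThan_Suc cN) simp
  finally have R: "R_op (coprod_E_op f) (x, y) =
      (\<Sum>l<N. ?c l * lowering l y * u (- (y - int l - p)) * ?Q (Suc l) * ?f (Suc l))
      + (?c 0 * ?Q 0 * ?f 0
         + (\<Sum>l<N. ?c (Suc l) * lowering (Suc l) y * ?Q (Suc l) * ?f (Suc l)))" .
  have "coprod_E (R_op f) (x, y) - R_op (coprod_E_op f) (x, y)
      = (\<Sum>l<N. (?c l * lowering l y * (u (y - p) - u (- (y - int l - p)))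
          + ?c (Suc l) * (lowering (Suc l) (y + 1) - lowering (Suc l) y)) * (?Q (Suc l) * ?f (Suc l)))"
    unfolding L R by (simp add: sum.distrib sum_subtractf algebra_simps)
  also have "\<dots> = 0" by (intro sum.neutral ballI) (simp only: intertwining_coefficients lessThan_iff mult_zero_left)
  finally show "coprod_E (R_op f) (x, y) = R_op (coprod_E_op f) (x, y)" by simp
qed

text \<open>For \<open>t < N\<close> this is \<open>R_coeff t \<cdot> \<Delta>(E)\<^sup>t\<close>, a divided power of \<open>\<Delta>(E)\<close> up to normalization,
  expanded by the \<open>q\<close>-binomial theorem. In this expanded form it occurs in \<open>R\<^sub>1\<^sub>3 R\<^sub>2\<^sub>3\<close>.\<close>

definition coprod_E_divpow :: "nat \<Rightarrow> (int \<times> int \<Rightarrow> complex) \<Rightarrow> int \<times> int \<Rightarrow> complex" where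
  "coprod_E_divpow t f = (\<lambda>(x, y). \<Sum>n\<le>t. R_coeff n * R_coeff (t - n)
     * u ((y + int n - p) * int (t - n)) * f (x + int (t - n), y + int n))"

lemma coprod_E_divpow_0: "coprod_E_divpow 0 f = f"
  using N_pos by (auto simp: coprod_E_divpow_def R_coeff_def)

text \<open>The \<open>q\<close>-Pascal rule \<open>1 - u\<^bsup>-(m + n)\<^esup> = (1 - u\<^bsup>-m\<^esup>) + u\<^bsup>-m\<^esup> (1 - u\<^bsup>-n\<^esup>)\<close>. The summands on the right
  come from \<open>E \<otimes> K\<close> and from \<open>1 \<otimes> E\<close>: each raises one of the two exponents, and
  \<open>R_coeff_rec\<close> turns the coefficient before the raise into the one after it. The factors
  \<open>1 - u\<^sup>0 = 0\<close> allow both sums to be extended to \<open>{..Suc t}\<close>.\<close>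

lemma coprod_E_divpow_Suc:
  assumes "Suc t < N"
  shows "(1 - u (- int (Suc t))) * coprod_E_divpow (Suc t) f z = divpow_scale * coprod_E_divpow t (coprod_E f) z"
proof -
  obtain x y where z: "z = (x, y)" by force
  let ?c = R_coeff
  let ?U = "\<lambda>n. u ((y + int n - p) * int (Suc t - n))"
  let ?f = "\<lambda>n. f (x + int (Suc t - n), y + int n)"
  let ?a = "\<lambda>n. ?c n * (?c (Suc t - n) * (1 - u (- int (Suc t - n)))) * ?U n * ?f n"
  let ?b = "\<lambda>n. (?c n * (1 - u (- int n))) * ?c (Suc t - n) * (?U n * u (- int (Suc t - n))) * ?f n"
  have 1: "(\<Sum>n\<le>t. ?c n * (divpow_scale * ?c (t - n)) * (u ((y + int n - p) * int (t - n)) * u (y + int n - p)) * ?f n)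
     = (\<Sum>n\<le>Suc t. ?a n)"
  proof -
    have "?c n * (divpow_scale * ?c (t - n)) * (u ((y + int n - p) * int (t - n)) * u (y + int n - p)) * ?f n = ?a n"
      if "n \<in> {..t}" for n
    proof -
      have s: "Suc t - n = Suc (t - n)" using that by simp
      have "Suc (t - n) < N" using assms by simp
      note r = R_coeff_rec[OF this]
      have "u ((y + int n - p) * int (t - n)) * u (y + int n - p) = ?U n"
        unfolding s by (simp flip: u_add add: algebra_simps)
      then show ?thesis unfolding s r by simp
    qed
    moreover have "?a (Suc t) = 0" by simp
    ultimately show ?thesis
      unfolding sum.atMost_Suc[of ?a] by (simp only: add_0_right) (rule sum.cong[OF refl], assumption)
  qed
  have 2: "(\<Sum>n\<le>t. divpow_scale * ?c n * ?c (t - n) * u ((y + int n - p) * int (t - n))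
        * f (x + int (t - n), y + int (Suc n))) = (\<Sum>n\<le>Suc t. ?b n)"
  proof -
    have "divpow_scale * ?c n * ?c (t - n) * u ((y + int n - p) * int (t - n))
        * f (x + int (t - n), y + int (Suc n)) = ?b (Suc n)" if "n \<in> {..t}" for n
    proof -
      have "Suc n < N" using assms that by simp
      note r = R_coeff_rec[OF this]
      have "u ((y + int n - p) * int (t - n)) = ?U (Suc n) * u (- int (Suc t - Suc n))"
        by (simp flip: u_add add: algebra_simps)
      then show ?thesis unfolding r by simp
    qed
    moreover have "?b 0 = 0" by simp
    ultimately show ?thesis
      unfolding sum.atMost_Suc_shift[of ?b] by (simp only: add_0) (rule sum.cong[OF refl], assumption)
  qed
  have "divpow_scale * coprod_E_divpow t (coprod_E f) z = (\<Sum>n\<le>Suc t. ?a n) + (\<Sum>n\<le>Suc t. ?b n)"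
    unfolding 1[symmetric] 2[symmetric] unfolding z coprod_E_divpow_def coprod_E_def prod.case
      sum_distrib_left sum.distrib[symmetric]
    by (intro sum.cong refl) (simp add: algebra_simps Suc_diff_le of_nat_diff)
  also have "\<dots> = (\<Sum>n\<le>Suc t. (1 - u (- int (Suc t))) * (?c n * ?c (Suc t - n) * ?U n * ?f n))"
    unfolding sum.distrib[symmetric]
  proof (intro sum.cong refl)
    fix n assume "n \<in> {..Suc t}"
    then have "u (- int n) * u (- int (Suc t - n)) = u (- int (Suc t))"
      by (simp flip: u_add add: of_nat_diff)
    then have "1 - u (- int (Suc t)) = (1 - u (- int (Suc t - n))) + (1 - u (- int n)) * u (- int (Suc t - n))"
      by (simp add: algebra_simps)
    then show "?a n + ?b n = (1 - u (- int (Suc t))) * (?c n * ?c (Suc t - n) * ?U n * ?f n)"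
      by (simp only: distrib_right distrib_left mult_ac)
  qed
  finally show ?thesis unfolding z coprod_E_divpow_def prod.case sum_distrib_left by simp
qed

lemma R_op_scale: "R_op (\<lambda>z. k * f z) = (\<lambda>z. k * R_op f z)"
  by (auto simp: R_op_def sum_distrib_left mult_ac)

lemma R_op_sum: "R_op (\<lambda>z. \<Sum>c\<in>C. f c z) = (\<lambda>z. \<Sum>c\<in>C. R_op (f c) z)"
proof (rule ext, clarify)
  fix x y
  show "R_op (\<lambda>z. \<Sum>c\<in>C. f c z) (x, y) = (\<Sum>c\<in>C. R_op (f c) (x, y))"
    unfolding R_op_def prod.case sum_distrib_left by (rule sum.swap)
qed

abbreviation coprod_E_op_divpow :: "nat \<Rightarrow> (int \<times> int \<Rightarrow> complex) \<Rightarrow> int \<times> int \<Rightarrow> complex" where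
  "coprod_E_op_divpow t f \<equiv> flip (coprod_E_divpow t (flip f))"

text \<open>For \<open>t < N\<close> the factors \<open>1 - u\<^bsup>-t\<^esup>\<close> are invertible, so the intertwining relation passes from
  \<open>\<Delta>(E)\<close> to its divided powers by induction.\<close>

lemma R_op_coprod_E_divpow:
  assumes "t < N"
  shows "coprod_E_divpow t (R_op f) = R_op (coprod_E_op_divpow t f)"
  using assms
proof (induction t arbitrary: f)
  case 0
  then show ?case by (simp add: coprod_E_divpow_0)
next
  case (Suc t)
  let ?k = "1 - u (- int (Suc t))"
  have k: "?k \<noteq> 0" using u_neq_1[OF _ Suc.prems] by simp
  have op: "(\<lambda>z. ?k * coprod_E_op_divpow (Suc t) f z) = (\<lambda>z. divpow_scale * coprod_E_op_divpow t (coprod_E_op f) z)"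
    using coprod_E_divpow_Suc[OF Suc.prems, of "flip f"] by (auto simp: flip_def)
  have "?k * coprod_E_divpow (Suc t) (R_op f) z = ?k * R_op (coprod_E_op_divpow (Suc t) f) z" for z
  proof -
    have "?k * coprod_E_divpow (Suc t) (R_op f) z = divpow_scale * coprod_E_divpow t (R_op (coprod_E_op f)) z"
      by (simp only: coprod_E_divpow_Suc[OF Suc.prems] R_op_coprod_E)
    also have "\<dots> = divpow_scale * R_op (coprod_E_op_divpow t (coprod_E_op f)) z"
      using Suc by simp
    also have "\<dots> = ?k * R_op (coprod_E_op_divpow (Suc t) f) z"
      using op R_op_scale by metis
    finally show ?thesis .
  qed
  then show ?case using k by auto
qed

section \<open>The Yang-Baxter equation for operators on functions\<close>

definition R12_op :: "(int \<times> int \<times> int \<Rightarrow> complex) \<Rightarrow> int \<times> int \<times> int \<Rightarrow> complex" where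
  "R12_op f = (\<lambda>(x, y, z). R_op (\<lambda>(x, y). f (x, y, z)) (x, y))"

definition R13_op :: "(int \<times> int \<times> int \<Rightarrow> complex) \<Rightarrow> int \<times> int \<times> int \<Rightarrow> complex" where
  "R13_op f = (\<lambda>(x, y, z). R_op (\<lambda>(x, z). f (x, y, z)) (x, z))"

definition R23_op :: "(int \<times> int \<times> int \<Rightarrow> complex) \<Rightarrow> int \<times> int \<times> int \<Rightarrow> complex" where
  "R23_op f = (\<lambda>(x, y, z). R_op (\<lambda>(y, z). f (x, y, z)) (y, z))"

text \<open>The term of \<open>R\<^sub>1\<^sub>3 R\<^sub>2\<^sub>3\<close> with \<open>F\<^sup>n\<close> from \<open>R\<^sub>2\<^sub>3\<close> and \<open>F\<^sup>m\<close> from \<open>R\<^sub>1\<^sub>3\<close> has \<open>F\<^bsup>n + m\<^esup>\<close> in the third leg.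
  It is zero if \<open>n + m \<ge> N\<close>, and the terms with \<open>n + m = t\<close> combine to the divided power of
  \<open>\<Delta>(E)\<close>: the factor \<open>K\<^sup>m\<close> in the second leg arises from evaluating \<open>q\<^bsup>H\<otimes>H/2\<^esup>\<close> on legs two and
  three before \<open>F\<^sup>m\<close> has acted.\<close>

lemma R23_R13_op:
  "R23_op (R13_op f) (x, y, z) = (\<Sum>t<N. lowering t z * u ((x + y + int t - 2 * p) * (z - int t - p))
     * coprod_E_divpow t (\<lambda>(x, y). f (x, y, z - int t)) (x, y))"
proof -
  let ?c = R_coeff
  let ?g = "\<lambda>n m. lowering (n + m) z * u ((x + y + int (n + m) - 2 * p) * (z - int (n + m) - p))
     * (?c n * ?c m * u ((y + int n - p) * int m) * f (x + int m, y + int n, z - int (n + m)))"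
  have "R23_op (R13_op f) (x, y, z) = (\<Sum>n<N. \<Sum>m<N. ?g n m)"
    unfolding R23_op_def R13_op_def R_op_def prod.case sum_distrib_left
  proof (intro sum.cong refl)
    fix n m
    have "u ((y + int n - p) * (z - int n - p)) * u ((x + int m - p) * (z - int n - int m - p))
        = u ((x + y + int (n + m) - 2 * p) * (z - int (n + m) - p)) * u ((y + int n - p) * int m)"
      by (simp flip: u_add add: algebra_simps)
    then show "?c n * lowering n z * u ((y + int n - p) * (z - int n - p)) *
        (?c m * lowering m (z - int n) * u ((x + int m - p) * (z - int n - int m - p)) *
         f (x + int m, y + int n, z - int n - int m)) = ?g n m"
      by (simp add: lowering_add mult_ac diff_diff_add)
  qed
  also have "\<dots> = (\<Sum>t<N. \<Sum>n\<le>t. ?g n (t - n))"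
    by (rule sum_lessThan_triangle) (simp add: lowering_ge_N)
  also have "\<dots> = (\<Sum>t<N. lowering t z * u ((x + y + int t - 2 * p) * (z - int t - p))
     * coprod_E_divpow t (\<lambda>(x, y). f (x, y, z - int t)) (x, y))"
    unfolding coprod_E_divpow_def prod.case sum_distrib_left
    by (intro sum.cong refl) simp
  finally show ?thesis .
qed

text \<open>Exchanging the first two legs exchanges \<open>R\<^sub>1\<^sub>3\<close> with \<open>R\<^sub>2\<^sub>3\<close> and the coproduct with its
  opposite.\<close>

lemma R13_R23_op:
  "R13_op (R23_op f) (x, y, z) = (\<Sum>t<N. lowering t z * u ((x + y + int t - 2 * p) * (z - int t - p))
     * coprod_E_op_divpow t (\<lambda>(x, y). f (x, y, z - int t)) (x, y))"
proof -
  have "R13_op (R23_op f) (x, y, z) = R23_op (R13_op (\<lambda>(x, y, z). f (y, x, z))) (y, x, z)"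
    by (simp add: R13_op_def R23_op_def)
  also have "\<dots> = (\<Sum>t<N. lowering t z * u ((x + y + int t - 2 * p) * (z - int t - p))
     * coprod_E_op_divpow t (\<lambda>(x, y). f (x, y, z - int t)) (x, y))"
    unfolding R23_R13_op by (simp add: flip_def add.commute[of x y])
  finally show ?thesis .
qed

text \<open>\<open>R\<close> preserves the total weight, since \<open>E\<^sup>l \<otimes> F\<^sup>l\<close> does.\<close>

lemma R_op_conserved: "R_op (\<lambda>(x, y). k (x + y) * f (x, y)) (x, y) = k (x + y) * R_op f (x, y)"
  by (simp add: R_op_def sum_distrib_left mult_ac)

lemma yang_baxter_op: "R23_op (R13_op (R12_op f)) = R12_op (R13_op (R23_op f))"
proof (rule ext, clarify)
  fix x y z
  let ?k = "\<lambda>t s. lowering t z * u ((s + int t - 2 * p) * (z - int t - p))"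
  let ?f = "\<lambda>t. \<lambda>(x, y). f (x, y, z - int t)"
  have "R23_op (R13_op (R12_op f)) (x, y, z) = (\<Sum>t<N. ?k t (x + y) * coprod_E_divpow t (R_op (?f t)) (x, y))"
    unfolding R23_R13_op by (simp add: R12_op_def)
  also have "\<dots> = (\<Sum>t<N. ?k t (x + y) * R_op (coprod_E_op_divpow t (?f t)) (x, y))"
    by (simp add: R_op_coprod_E_divpow)
  also have "\<dots> = (\<Sum>t<N. R_op (\<lambda>(x, y). ?k t (x + y) * coprod_E_op_divpow t (?f t) (x, y)) (x, y))"
    by (intro sum.cong refl R_op_conserved[symmetric])
  also have "\<dots> = R_op (\<lambda>w. \<Sum>t<N. (\<lambda>(x, y). ?k t (x + y) * coprod_E_op_divpow t (?f t) (x, y)) w) (x, y)"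
    by (simp only: R_op_sum)
  also have "\<dots> = R12_op (R13_op (R23_op f)) (x, y, z)"
    unfolding R12_op_def prod.case by (intro arg_cong[where f = "\<lambda>g. R_op g _"] ext) (auto simp: R13_R23_op)
  finally show "R23_op (R13_op (R12_op f)) (x, y, z) = R12_op (R13_op (R23_op f)) (x, y, z)" .
qed

section \<open>The semicyclic representation on a family indexed by the integers\<close>

text \<open>The \<open>r\<close>-th coordinate of \<open>w\<^sub>y = v\<^bsub>y + i\<^esub>\<close>, where \<open>v\<^bsub>m + N\<^esub> = a v\<^sub>m\<close>.\<close>

definition cyclic_vec :: "complex \<Rightarrow> nat \<Rightarrow> int \<Rightarrow> nat \<Rightarrow> complex" where
  "cyclic_vec a i y r = (if int r = (y + int i) mod int N then a powi ((y + int i) div int N) else 0)"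

lemma cyclic_vec_sum:
  "(\<Sum>c<N. g c * cyclic_vec a i y c)
     = g (nat ((y + int i) mod int N)) * a powi ((y + int i) div int N)"
proof -
  let ?c = "nat ((y + int i) mod int N)"
  have c: "int ?c = (y + int i) mod int N" "?c < N"
    using N_pos by (simp_all add: nat_less_iff)
  have "(\<Sum>c<N. g c * cyclic_vec a i y c)
      = (\<Sum>c<N. if c = ?c then g c * a powi ((y + int i) div int N) else 0)"
    using c(1) by (intro sum.cong) (auto simp: cyclic_vec_def)
  then show ?thesis using c(2) by (simp add: sum.delta)
qed

lemma realizes_E:
  assumes "a \<noteq> 0"
  shows "realizes N (cyclic_vec a i) (semicyclic N a i E) (\<lambda>f y. f (y + 1))"
proof -
  have "(\<Sum>c<N. semicyclic N a i E $$ (r, c) * cyclic_vec a i y c) = cyclic_vec a i (y + 1) r"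
    if "r < N" for y r
  proof -
    define m d where "m = (y + int i) mod int N" and "d = (y + int i) div int N"
    have m: "0 \<le> m" "m < int N" using N_pos by (simp_all add: m_def)
    have ym: "y + int i = m + int N * d" by (simp add: m_def d_def)
    have y1: "(y + 1 + int i) = (m + 1) + int N * d" using ym by simp
    have y2: "(y + 1 + int i) = int N * (d + 1)" if "m = int N - 1"
      using ym that by (simp add: distrib_left)
    have 1: "(y + 1 + int i) mod int N = (if m < int N - 1 then m + 1 else 0)"
    proof (cases "m < int N - 1")
      case True
      then show ?thesis unfolding y1 using m by (simp add: mod_pos_pos_trivial)
    next
      case False
      then show ?thesis using m y2 by simp
    qed
    have 2: "(y + 1 + int i) div int N = (if m < int N - 1 then d else d + 1)"
    proof (cases "m < int N - 1")
      case True
      then show ?thesis unfolding y1 using m by (simp add: div_pos_pos_trivial)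
    next
      case False
      then have "y + 1 + int i = int N * (d + 1)" using m y2 by simp
      then have "(y + 1 + int i) div int N = d + 1" using N_pos by (metis nonzero_mult_div_cancel_left of_nat_0_less_iff less_irrefl)
      then show ?thesis using False by simp
    qed
    have "nat m < N" using m by auto
    then show ?thesis
      unfolding cyclic_vec_sum m_def[symmetric] d_def[symmetric]
      unfolding cyclic_vec_def 1 2
      using that m assms by (auto simp: monomial_mat_def power_int_add nat_less_iff of_nat_diff)
  qed
  then show ?thesis by (simp add: realizes_def)
qed

lemma realizes_F:
  assumes "a \<noteq> 0"
  shows "realizes N (cyclic_vec a i) (semicyclic N a i F) (\<lambda>f y. (qnum N y)\<^sup>2 * f (y - 1))"
proof -
  have "(\<Sum>c<N. semicyclic N a i F $$ (r, c) * cyclic_vec a i y c)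
      = (qnum N y)\<^sup>2 * cyclic_vec a i (y - 1) r"
    if "r < N" for y r
  proof -
    define m d where "m = (y + int i) mod int N" and "d = (y + int i) div int N"
    have m: "0 \<le> m" "m < int N" using N_pos by (simp_all add: m_def)
    have ym: "y + int i = m + int N * d" by (simp add: m_def d_def)
    have y1: "(y - 1 + int i) = (m - 1) + int N * d" using ym by simp
    have y2: "(y - 1 + int i) = (int N - 1) + int N * (d - 1)" if "m = 0" 
      using ym that by (simp add: right_diff_distrib)
    have 1: "(y - 1 + int i) mod int N = (if m \<noteq> 0 then m - 1 else int N - 1)"
    proof (cases "m = 0")
      case True
      have "(y - 1 + int i) mod int N = (int N - 1) mod int N"
        unfolding y2[OF True] by (rule mod_mult_self2)
      then show ?thesis using True N_pos by (simp only: mod_pos_pos_trivial) simp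
    next
      case False
      then show ?thesis unfolding y1 using m by (simp add: mod_pos_pos_trivial)
    qed
    have 2: "(y - 1 + int i) div int N = (if m \<noteq> 0 then d else d - 1)"
    proof (cases "m = 0")
      case True
      then show ?thesis unfolding y2[OF True] using N_pos by (simp add: div_pos_pos_trivial)
    next
      case False
      then show ?thesis unfolding y1 using m N_pos by (simp add: div_pos_pos_trivial)
    qed
    have "(m - int i) mod int N = y mod int N"
      unfolding m_def by (simp add: mod_diff_left_eq)
    then have f: "qnum N ((m - int i) mod int N) * qnum N (int N - (m - int i) mod int N) = (qnum N y)\<^sup>2"
      using qnum_square_mod[OF N_pos, of y] by simp
    have "nat m < N" using m by auto
    then show ?thesis
      unfolding cyclic_vec_sum m_def[symmetric] d_def[symmetric]
      unfolding cyclic_vec_def 1 2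
      using that m assms N_pos f
      by (auto simp: monomial_mat_def power_int_diff nat_less_iff of_nat_diff Let_def nat_eq_iff)
  qed
  then show ?thesis by (simp add: realizes_def)
qed

lemma realizes_E_pow:
  assumes "a \<noteq> 0"
  shows "realizes N (cyclic_vec a i) (semicyclic N a i E ^\<^sub>m l) (\<lambda>f y. f (y + int l))"
proof (induction l)
  case 0
  then show ?case using realizes_one[of N "cyclic_vec a i"] carrier_matD(1)[OF semicyclic_carrier[of N a i E]] by simp
next
  case (Suc l)
  from realizes_mult[OF Suc realizes_E[OF assms]] show ?case by (simp add: algebra_simps)
qed

lemma realizes_F_pow:
  assumes "a \<noteq> 0"
  shows "realizes N (cyclic_vec a i) (semicyclic N a i F ^\<^sub>m l) (\<lambda>f y. lowering l y * f (y - int l))"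
proof (induction l)
  case 0
  then show ?case using realizes_one[of N "cyclic_vec a i"] carrier_matD(1)[OF semicyclic_carrier[of N a i F]] by simp
next
  case (Suc l)
  have "lowering (Suc l) y = (qnum N y)\<^sup>2 * lowering l (y - 1)" for y
    using lowering_Suc_shift[of l "y - 1"] by simp
  then show ?case using realizes_mult[OF Suc realizes_F[OF assms]]
    by (simp add: algebra_simps sum_distrib_left)
qed

section \<open>Tensor powers and the matrices of \<open>R\<close>\<close>

definition cyclic_vec2 :: "complex \<Rightarrow> nat \<Rightarrow> int \<times> int \<Rightarrow> nat \<Rightarrow> complex" where
  "cyclic_vec2 a i = (\<lambda>(x, y) r. cyclic_vec a i x (r div N) * cyclic_vec a i y (r mod N))"

definition cyclic_vec3 :: "complex \<Rightarrow> nat \<Rightarrow> int \<times> int \<times> int \<Rightarrow> nat \<Rightarrow> complex" where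
  "cyclic_vec3 a i = (\<lambda>(x, y, z) r. cyclic_vec2 a i (x, y) (r div N) * cyclic_vec a i z (r mod N))"

lemma cyclic_vec2_digits:
  "k < N \<Longrightarrow> cyclic_vec2 a i (x, y) (j * N + k) = cyclic_vec a i x j * cyclic_vec a i y k"
  by (simp add: cyclic_vec2_def)

lemma cyclic_vec3_digits:
  "k < N \<Longrightarrow> l < N \<Longrightarrow> cyclic_vec3 a i (x, y, z) ((j * N + k) * N + l)
     = cyclic_vec a i x j * cyclic_vec a i y k * cyclic_vec a i z l"
  by (simp add: cyclic_vec3_def cyclic_vec2_digits)

text \<open>The weight of the basis vector \<open>v\<^sub>r\<close> proportional to \<open>w\<^sub>x\<close> is \<open>2 (x - p)\<close> up to a multiple of
  \<open>2 N\<close>. Half the product of two such weights is even and changes by multiples of \<open>2 N\<close> only.\<close>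

lemma qHH_eigenvalue:
  assumes "r < N" "s < N" and "cyclic_vec a i x r \<noteq> 0" "cyclic_vec a i y s \<noteq> 0"
  shows "qpow N (of_int (weight N i r * weight N i s) / 2) = u ((x - p) * (y - p))"
proof -
  have r: "int r = (x + int i) mod int N" and s: "int s = (y + int i) mod int N"
    using assms by (auto simp: cyclic_vec_def split: if_splits)
  have w: "weight N i j = 2 * (int j - int i - p)" for j
    using two_p by (simp add: weight_def)
  have "of_int (weight N i r * weight N i s) / 2 = real_of_int (2 * ((int r - int i - p) * (int s - int i - p)))"
  proof -
    have "real_of_int (2 * A * (2 * B)) / 2 = real_of_int (2 * (A * B))" for A B :: int
      by simp
    then show ?thesis unfolding w .
  qed
  then have "qpow N (of_int (weight N i r * weight N i s) / 2) = u ((int r - int i - p) * (int s - int i - p))"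
    by (simp only: qpow_of_int u_def)
  also have "\<dots> = u ((x - p) * (y - p))"
  proof (rule u_cong, rule mod_mult_cong)
    show "(int r - int i - p) mod int N = (x - p) mod int N"
      unfolding r by (metis add_diff_cancel_right' mod_diff_left_eq)
    show "(int s - int i - p) mod int N = (y - p) mod int N"
      unfolding s by (metis add_diff_cancel_right' mod_diff_left_eq)
  qed
  finally show ?thesis .
qed

lemma R_matrix_carrier: "R_matrix N a i \<in> carrier_mat (N * N) (N * N)"
  by (simp add: R_matrix_def qHH_def R_sum_def carrier_matI)

lemma R_matrix_index:
  assumes "r < N * N" "c < N * N"
  shows "R_matrix N a i $$ (r, c) = qpow N (of_int (weight N i (r div N) * weight N i (r mod N)) / 2)
     * (\<Sum>l<N. R_coeff l * kron (semicyclic N a i E ^\<^sub>m l) (semicyclic N a i F ^\<^sub>m l) $$ (r, c))"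
proof -
  let ?q = "qpow N (of_int (weight N i (r div N) * weight N i (r mod N)) / 2)"
  have "R_matrix N a i $$ (r, c) = (\<Sum>k<N * N. qHH N i $$ (r, k) * R_sum N (semicyclic N a i) $$ (k, c))"
    using assms by (simp add: R_matrix_def qHH_def R_sum_def scalar_prod_def lessThan_atLeast0)
  also have "\<dots> = (\<Sum>k<N * N. if k = r then ?q * R_sum N (semicyclic N a i) $$ (k, c) else 0)"
    using assms by (intro sum.cong) (auto simp: qHH_def)
  also have "\<dots> = ?q * R_sum N (semicyclic N a i) $$ (r, c)"
    using assms by (simp add: sum.delta)
  also have "R_sum N (semicyclic N a i) $$ (r, c)
      = (\<Sum>l<N. R_coeff l * kron (semicyclic N a i E ^\<^sub>m l) (semicyclic N a i F ^\<^sub>m l) $$ (r, c))"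
  proof -
    have "{0..N - 1} = {..<N}" using N_pos by auto
    then show ?thesis using assms by (simp add: R_sum_def R_coeff_def)
  qed
  finally show ?thesis .
qed

lemma kron_action:
  assumes A: "realizes N W A f" and B: "realizes N W B g" and "j < N" "k < N"
  shows "(\<Sum>m<N. \<Sum>n<N. kron A B $$ (j * N + k, m * N + n) * (W x m * W y n))
     = f (\<lambda>x. W x j) x * g (\<lambda>y. W y k) y"
proof -
  have carrier: "A \<in> carrier_mat N N" "B \<in> carrier_mat N N"
    using A B by (auto simp: realizes_def)
  have "(\<Sum>m<N. \<Sum>n<N. kron A B $$ (j * N + k, m * N + n) * (W x m * W y n))
     = (\<Sum>m<N. \<Sum>n<N. (A $$ (j, m) * W x m) * (B $$ (k, n) * W y n))"
    using assms(3,4) by (intro sum.cong refl) (simp add: kron_index[OF carrier])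
  then show ?thesis using assms by (simp add: sum_product[symmetric] realizes_def)
qed

lemma realizes_R_matrix:
  assumes "a \<noteq> 0"
  shows "realizes (N * N) (cyclic_vec2 a i) (R_matrix N a i) R_op"
proof -
  let ?W = "cyclic_vec a i"
  have "(\<Sum>c<N * N. R_matrix N a i $$ (r, c) * cyclic_vec2 a i (x, y) c)
      = R_op (\<lambda>w. cyclic_vec2 a i w r) (x, y)" if r: "r < N * N" for r x y
  proof -
    define j k where "j = r div N" and "k = r mod N"
    have jk: "j < N" "k < N" "r = j * N + k"
      using r N_pos by (simp_all add: j_def k_def less_mult_imp_div_less)
    let ?q = "qpow N (of_int (weight N i j * weight N i k) / 2)"
    let ?K = "\<lambda>l. kron (semicyclic N a i E ^\<^sub>m l) (semicyclic N a i F ^\<^sub>m l)"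
    have "(\<Sum>c<N * N. R_matrix N a i $$ (r, c) * cyclic_vec2 a i (x, y) c)
        = (\<Sum>m<N. \<Sum>n<N. \<Sum>l<N. ?q * R_coeff l * (?K l $$ (j * N + k, m * N + n) * (?W x m * ?W y n)))"
      unfolding sum_digits
      using r by (intro sum.cong refl)
        (simp add: R_matrix_index digits_less cyclic_vec2_digits j_def[symmetric] k_def[symmetric]
          sum_distrib_left sum_distrib_right mult_ac, simp add: jk mult_ac)
    also have "\<dots> = (\<Sum>m<N. \<Sum>l<N. \<Sum>n<N. ?q * R_coeff l * (?K l $$ (j * N + k, m * N + n) * (?W x m * ?W y n)))"
      by (intro sum.cong refl sum.swap)
    also have "\<dots> = (\<Sum>l<N. \<Sum>m<N. \<Sum>n<N. ?q * R_coeff l * (?K l $$ (j * N + k, m * N + n) * (?W x m * ?W y n)))"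
      by (rule sum.swap)
    also have "\<dots> = (\<Sum>l<N. ?q * R_coeff l * (?W (x + int l) j * (lowering l y * ?W (y - int l) k)))"
      by (simp only: sum_distrib_left[symmetric] kron_action[OF realizes_E_pow[OF assms] realizes_F_pow[OF assms] jk(1,2)])
    also have "\<dots> = (\<Sum>l<N. R_coeff l * lowering l y * u ((x + int l - p) * (y - int l - p))
        * (?W (x + int l) j * ?W (y - int l) k))"
    proof (intro sum.cong refl)
      fix l
      show "?q * R_coeff l * (?W (x + int l) j * (lowering l y * ?W (y - int l) k))
          = R_coeff l * lowering l y * u ((x + int l - p) * (y - int l - p))
            * (?W (x + int l) j * ?W (y - int l) k)"
        using qHH_eigenvalue[OF jk(1,2), of a i "x + int l" "y - int l"]
        by (cases "?W (x + int l) j = 0 \<or> ?W (y - int l) k = 0") auto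
    qed
    also have "\<dots> = R_op (\<lambda>w. cyclic_vec2 a i w r) (x, y)"
      by (simp add: R_op_def cyclic_vec2_def j_def k_def)
    finally show ?thesis .
  qed
  then show ?thesis using R_matrix_carrier by (auto simp: realizes_def)
qed

text \<open>Reduces the action on the triple tensor product to sums over the three base-\<open>N\<close> digits, on which
  the entries of the three leg matrices factor.\<close>

lemma realizes_cyclic_vec3I:
  assumes "A \<in> carrier_mat (N * N * N) (N * N * N)"
    and "\<And>x y z r s t. r < N \<Longrightarrow> s < N \<Longrightarrow> t < N \<Longrightarrow>
      (\<Sum>j<N. \<Sum>k<N. \<Sum>l<N. A $$ ((r * N + s) * N + t, (j * N + k) * N + l)
         * (cyclic_vec a i x j * cyclic_vec a i y k * cyclic_vec a i z l))
      = f (\<lambda>(x, y, z). cyclic_vec a i x r * cyclic_vec a i y s * cyclic_vec a i z t) (x, y, z)"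
  shows "realizes (N * N * N) (cyclic_vec3 a i) A f"
  unfolding realizes_def
proof (intro conjI assms(1) allI impI)
  fix w :: "int \<times> int \<times> int" and r assume r: "r < N * N * N"
  obtain x y z where w: "w = (x, y, z)" by (cases w)
  define r1 r2 r3 where "r1 = r div N div N" and "r2 = r div N mod N" and "r3 = r mod N"
  have rs: "r1 < N" "r2 < N" "r3 < N" "r = (r1 * N + r2) * N + r3"
    using r N_pos by (simp_all add: r1_def r2_def r3_def less_mult_imp_div_less)
  have "(\<lambda>w. cyclic_vec3 a i w r)
      = (\<lambda>(x, y, z). cyclic_vec a i x r1 * cyclic_vec a i y r2 * cyclic_vec a i z r3)"
    unfolding rs(4) using rs by (auto simp: cyclic_vec3_digits)
  moreover have "(\<Sum>c<N * N * N. A $$ (r, c) * cyclic_vec3 a i w c)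
      = (\<Sum>j<N. \<Sum>k<N. \<Sum>l<N. A $$ (r, (j * N + k) * N + l)
         * (cyclic_vec a i x j * cyclic_vec a i y k * cyclic_vec a i z l))"
    unfolding sum_digits w by (intro sum.cong refl) (simp add: cyclic_vec3_digits)
  ultimately show "(\<Sum>c<N * N * N. A $$ (r, c) * cyclic_vec3 a i w c) = f (\<lambda>w. cyclic_vec3 a i w r) w"
    using assms(2)[OF rs(1-3), of x y z] unfolding w rs(4) by simp
qed

lemma R_action_digits:
  assumes "a \<noteq> 0" "r < N" "s < N"
  shows "(\<Sum>j<N. \<Sum>k<N. R_matrix N a i $$ (r * N + s, j * N + k) * (cyclic_vec a i x j * cyclic_vec a i y k))
     = R_op (\<lambda>(x, y). cyclic_vec a i x r * cyclic_vec a i y s) (x, y)"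
proof -
  have "(\<lambda>w. cyclic_vec2 a i w (r * N + s)) = (\<lambda>(x, y). cyclic_vec a i x r * cyclic_vec a i y s)"
    using assms by (auto simp: cyclic_vec2_digits)
  moreover have "(\<Sum>j<N. \<Sum>k<N. R_matrix N a i $$ (r * N + s, j * N + k) * (cyclic_vec a i x j * cyclic_vec a i y k))
      = (\<Sum>c<N * N. R_matrix N a i $$ (r * N + s, c) * cyclic_vec2 a i (x, y) c)"
    unfolding sum_digits by (intro sum.cong refl) (simp add: cyclic_vec2_digits)
  ultimately show ?thesis
    using realizes_R_matrix[OF assms(1), of i] digits_less[OF assms(2,3)] by (simp add: realizes_def)
qed

lemma realizes_leg12:
  assumes "a \<noteq> 0"
  shows "realizes (N * N * N) (cyclic_vec3 a i) (leg12 N (R_matrix N a i)) R12_op"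
proof (rule realizes_cyclic_vec3I)
  let ?R = "R_matrix N a i" and ?W = "cyclic_vec a i"
  show "leg12 N ?R \<in> carrier_mat (N * N * N) (N * N * N)"
    by (simp add: leg12_def R_matrix_carrier)
  fix x y z r s t assume rst: "r < N" "s < N" "t < N"
  have "(\<Sum>j<N. \<Sum>k<N. \<Sum>l<N. leg12 N ?R $$ ((r * N + s) * N + t, (j * N + k) * N + l) * (?W x j * ?W y k * ?W z l))
      = (\<Sum>j<N. \<Sum>k<N. ?R $$ (r * N + s, j * N + k) * (?W x j * ?W y k)) * ?W z t"
    unfolding sum_distrib_right
  proof (intro sum.cong refl)
    fix j k assume jk: "j \<in> {..<N}" "k \<in> {..<N}"
    have "(\<Sum>l<N. leg12 N ?R $$ ((r * N + s) * N + t, (j * N + k) * N + l) * (?W x j * ?W y k * ?W z l))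
        = (\<Sum>l<N. if l = t then ?R $$ (r * N + s, j * N + k) * (?W x j * ?W y k) * ?W z l else 0)"
      using jk rst by (intro sum.cong refl)
        (auto simp: leg12_def kron_index[OF R_matrix_carrier one_carrier_mat] digits_less)
    then show "(\<Sum>l<N. leg12 N ?R $$ ((r * N + s) * N + t, (j * N + k) * N + l) * (?W x j * ?W y k * ?W z l))
        = ?R $$ (r * N + s, j * N + k) * (?W x j * ?W y k) * ?W z t"
      using rst by simp
  qed
  also have "\<dots> = R12_op (\<lambda>(x, y, z). ?W x r * ?W y s * ?W z t) (x, y, z)"
    unfolding R_action_digits[OF assms rst(1,2)] R12_op_def R_op_def prod.case sum_distrib_right
    by (intro sum.cong refl) (simp add: mult_ac)
  finally show "(\<Sum>j<N. \<Sum>k<N. \<Sum>l<N. leg12 N ?R $$ ((r * N + s) * N + t, (j * N + k) * N + l) * (?W x j * ?W y k * ?W z l))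
      = R12_op (\<lambda>(x, y, z). ?W x r * ?W y s * ?W z t) (x, y, z)" .
qed

lemma realizes_leg13:
  assumes "a \<noteq> 0"
  shows "realizes (N * N * N) (cyclic_vec3 a i) (leg13 N (R_matrix N a i)) R13_op"
proof (rule realizes_cyclic_vec3I)
  let ?R = "R_matrix N a i" and ?W = "cyclic_vec a i"
  show "leg13 N ?R \<in> carrier_mat (N * N * N) (N * N * N)"
    by (simp add: leg13_def)
  fix x y z r s t assume rst: "r < N" "s < N" "t < N"
  have entry: "leg13 N ?R $$ ((r * N + s) * N + t, (j * N + k) * N + l)
      = (if k = s then ?R $$ (r * N + t, j * N + l) else 0)" if "j < N" "k < N" "l < N" for j k l
    using that rst by (auto simp: leg13_def digits_less div_mult2_eq)
  have "(\<Sum>j<N. \<Sum>k<N. \<Sum>l<N. leg13 N ?R $$ ((r * N + s) * N + t, (j * N + k) * N + l) * (?W x j * ?W y k * ?W z l))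
      = (\<Sum>j<N. \<Sum>l<N. ?R $$ (r * N + t, j * N + l) * (?W x j * ?W z l)) * ?W y s"
    unfolding sum_distrib_right
  proof (rule sum.cong[OF refl])
    fix j assume j: "j \<in> {..<N}"
    have "(\<Sum>k<N. \<Sum>l<N. leg13 N ?R $$ ((r * N + s) * N + t, (j * N + k) * N + l) * (?W x j * ?W y k * ?W z l))
        = (\<Sum>k<N. if k = s then \<Sum>l<N. ?R $$ (r * N + t, j * N + l) * (?W x j * ?W z l) * ?W y k else 0)"
      using j by (intro sum.cong refl) (auto simp: entry mult.assoc mult.left_commute mult.commute[of "?W y s"])
    then show "(\<Sum>k<N. \<Sum>l<N. leg13 N ?R $$ ((r * N + s) * N + t, (j * N + k) * N + l) * (?W x j * ?W y k * ?W z l))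
        = (\<Sum>l<N. ?R $$ (r * N + t, j * N + l) * (?W x j * ?W z l) * ?W y s)"
      using rst by simp
  qed
  also have "\<dots> = R13_op (\<lambda>(x, y, z). ?W x r * ?W y s * ?W z t) (x, y, z)"
    unfolding R_action_digits[OF assms rst(1,3)] R13_op_def R_op_def prod.case sum_distrib_right
    by (intro sum.cong refl) (simp add: mult_ac)
  finally show "(\<Sum>j<N. \<Sum>k<N. \<Sum>l<N. leg13 N ?R $$ ((r * N + s) * N + t, (j * N + k) * N + l) * (?W x j * ?W y k * ?W z l))
      = R13_op (\<lambda>(x, y, z). ?W x r * ?W y s * ?W z t) (x, y, z)" .
qed

lemma realizes_leg23:
  assumes "a \<noteq> 0"
  shows "realizes (N * N * N) (cyclic_vec3 a i) (leg23 N (R_matrix N a i)) R23_op"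
proof (rule realizes_cyclic_vec3I)
  let ?R = "R_matrix N a i" and ?W = "cyclic_vec a i"
  show "leg23 N ?R \<in> carrier_mat (N * N * N) (N * N * N)"
    using kron_carrier[OF one_carrier_mat R_matrix_carrier] by (simp add: leg23_def mult.assoc)
  fix x y z r s t assume rst: "r < N" "s < N" "t < N"
  have entry: "leg23 N ?R $$ ((r * N + s) * N + t, (j * N + k) * N + l)
      = (if j = r then ?R $$ (s * N + t, k * N + l) else 0)" if "j < N" "k < N" "l < N" for j k l
  proof -
    have "(j * N + k) * N + l = j * (N * N) + (k * N + l)" for j k l :: nat
      by (simp add: algebra_simps)
    then show ?thesis
      using that rst
      by (simp only: leg23_def kron_index[OF one_carrier_mat R_matrix_carrier] digits_less) simp
  qed
  have "(\<Sum>j<N. \<Sum>k<N. \<Sum>l<N. leg23 N ?R $$ ((r * N + s) * N + t, (j * N + k) * N + l) * (?W x j * ?W y k * ?W z l))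
      = (\<Sum>j<N. if j = r then (\<Sum>k<N. \<Sum>l<N. ?R $$ (s * N + t, k * N + l) * (?W y k * ?W z l)) * ?W x j else 0)"
  proof (rule sum.cong[OF refl])
    fix j assume j: "j \<in> {..<N}"
    have "leg23 N ?R $$ ((r * N + s) * N + t, (j * N + k) * N + l) * (?W x j * ?W y k * ?W z l)
        = (if j = r then ?R $$ (s * N + t, k * N + l) * (?W y k * ?W z l) * ?W x j else 0)"
      if "k < N" "l < N" for k l
      using j that by (simp add: entry)
    then show "(\<Sum>k<N. \<Sum>l<N. leg23 N ?R $$ ((r * N + s) * N + t, (j * N + k) * N + l) * (?W x j * ?W y k * ?W z l))
        = (if j = r then (\<Sum>k<N. \<Sum>l<N. ?R $$ (s * N + t, k * N + l) * (?W y k * ?W z l)) * ?W x j else 0)"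
      by (simp add: sum_distrib_right)
  qed
  also have "\<dots> = (\<Sum>k<N. \<Sum>l<N. ?R $$ (s * N + t, k * N + l) * (?W y k * ?W z l)) * ?W x r"
    using rst by simp
  also have "\<dots> = R23_op (\<lambda>(x, y, z). ?W x r * ?W y s * ?W z t) (x, y, z)"
    unfolding R_action_digits[OF assms rst(2,3)] R23_op_def R_op_def prod.case sum_distrib_right
    by (intro sum.cong refl) (simp add: mult_ac)
  finally show "(\<Sum>j<N. \<Sum>k<N. \<Sum>l<N. leg23 N ?R $$ ((r * N + s) * N + t, (j * N + k) * N + l) * (?W x j * ?W y k * ?W z l))
      = R23_op (\<lambda>(x, y, z). ?W x r * ?W y s * ?W z t) (x, y, z)" .
qed

lemma R_op_linear: "R_op (\<lambda>w. \<Sum>c\<in>C. k c * f c w) = (\<lambda>w. \<Sum>c\<in>C. k c * R_op (f c) w)"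
  by (simp only: R_op_sum R_op_scale)

lemma R12_op_linear: "R12_op (\<lambda>w. \<Sum>c\<in>C. k c * f c w) = (\<lambda>w. \<Sum>c\<in>C. k c * R12_op (f c) w)"
proof -
  have "(\<lambda>(x, y). \<Sum>c\<in>C. k c * f c (x, y, z)) = (\<lambda>w. \<Sum>c\<in>C. k c * (\<lambda>(x, y). f c (x, y, z)) w)" for z
    by auto
  then show ?thesis by (intro ext) (clarsimp simp only: R12_op_def prod.case R_op_linear)
qed

lemma R13_op_linear: "R13_op (\<lambda>w. \<Sum>c\<in>C. k c * f c w) = (\<lambda>w. \<Sum>c\<in>C. k c * R13_op (f c) w)"
proof -
  have "(\<lambda>(x, z). \<Sum>c\<in>C. k c * f c (x, y, z)) = (\<lambda>w. \<Sum>c\<in>C. k c * (\<lambda>(x, z). f c (x, y, z)) w)" for y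
    by auto
  then show ?thesis by (intro ext) (clarsimp simp only: R13_op_def prod.case R_op_linear)
qed

lemma R23_op_linear: "R23_op (\<lambda>w. \<Sum>c\<in>C. k c * f c w) = (\<lambda>w. \<Sum>c\<in>C. k c * R23_op (f c) w)"
proof -
  have "(\<lambda>(y, z). \<Sum>c\<in>C. k c * f c (x, y, z)) = (\<lambda>w. \<Sum>c\<in>C. k c * (\<lambda>(y, z). f c (x, y, z)) w)" for x
    by auto
  then show ?thesis by (intro ext) (clarsimp simp only: R23_op_def prod.case R_op_linear)
qed

text \<open>The family contains the standard basis, so a matrix is determined by its operator.\<close>

lemma cyclic_vec3_basis:
  assumes "c < N * N * N"
  shows "\<exists>w. \<forall>d<N * N * N. cyclic_vec3 a i w d = (if d = c then 1 else 0)"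
proof (intro exI allI impI)
  let ?b = "\<lambda>c. int c - int i"
  let ?w = "(?b (c div N div N), ?b (c div N mod N), ?b (c mod N))"
  fix d assume "d < N * N * N"
  have b: "cyclic_vec a i (?b k) j = (if j = k then 1 else 0)" if "k < N" for j k
    using that by (simp add: cyclic_vec_def div_pos_pos_trivial)
  have "d = c \<longleftrightarrow> d div N div N = c div N div N \<and> d div N mod N = c div N mod N \<and> d mod N = c mod N"
    by (metis div_mult_mod_eq)
  then show "cyclic_vec3 a i ?w d = (if d = c then 1 else 0)"
    using assms N_pos by (simp add: cyclic_vec3_def cyclic_vec2_def b less_mult_imp_div_less)
qed

lemma yang_baxter_matrix:
  fixes i :: nat
  assumes "a \<noteq> 0"
  defines "R \<equiv> R_matrix N a i"
  shows "leg12 N R * leg13 N R * leg23 N R = leg23 N R * leg13 N R * leg12 N R"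
proof -
  note r12 = realizes_leg12[OF assms(1), of i, folded R_def]
    and r13 = realizes_leg13[OF assms(1), of i, folded R_def]
    and r23 = realizes_leg23[OF assms(1), of i, folded R_def]
  note L = realizes_mult[OF realizes_mult[OF r12 r13 R13_op_linear] r23 R23_op_linear]
  note R = realizes_mult[OF realizes_mult[OF r23 r13 R13_op_linear] r12 R12_op_linear]
  show ?thesis
    by (rule realizes_unique[OF L _ cyclic_vec3_basis]) (use R in \<open>simp_all add: yang_baxter_op\<close>)
qed

end

theorem theorem3p3:
  fixes N i :: nat and a :: complex
  assumes "N \<ge> 3" and "odd N" and "a \<noteq> 0" and "i < N"
  shows "let R = R_matrix N a i;
             R12 = leg12 N R; R13 = leg13 N R; R23 = leg23 N R
         in R12 * R13 * R23 - R23 * R13 * R12 = 0\<^sub>m (N * N * N) (N * N * N)"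
proof -
  interpret odd_root_of_unity N by unfold_locales (use assms in auto)
  let ?R = "R_matrix N a i"
  have "leg23 N ?R * leg13 N ?R * leg12 N ?R \<in> carrier_mat (N * N * N) (N * N * N)"
    using realizes_leg12[OF assms(3), of i] realizes_leg23[OF assms(3), of i] realizes_leg13[OF assms(3), of i]
    by (auto simp: realizes_def)
  then show ?thesis
    unfolding Let_def yang_baxter_matrix[OF assms(3)] by simp
qed

end
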